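(* Let $n \in \mathbb{N}$ and $d \in \mathbb{N}_0$ satisfy: (i) $n$ and $d$ are both even, and at least one of them is divisible by $4$; and (ii) $d \ge 4$ and $n \ge d+4$. Then there exists a $d$-regular nut graph of order $n$ of the form $\mathrm{Cay}(\Gamma, C)$ where $\Gamma$ is either a cyclic group or a dihedral group.
   Context: For a finite group $\Gamma$ with identity $e$ and $C \subseteq \Gamma\setminus\{e\}$ closed under inversion, $\mathrm{Cay}(\Gamma, C)$ is the graph with vertex set $\Gamma$ in which $u,v$ are adjacent iff $vu^{-1}\in C$. The dihedral group of order $2m$ ($m\ge3$) is $\langle r, s \mid r^m = s^2 = e,\ srs = r^{-1}\rangle$. A nut graph is a graph with at least two vertices whose adjacency matrix has eigenvalue $0$ with multiplicity exactly one, such that the corresponding eigenvector has no zero entries. *)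

theory Defs
  imports Complex_Main "HOL-Algebra.Group"
begin

definition neighbours :: "'a set \<Rightarrow> ('a \<Rightarrow> 'a \<Rightarrow> bool) \<Rightarrow> 'a \<Rightarrow> 'a set" where
  "neighbours V adj u = {v \<in> V. adj u v}"

definition regular_graph :: "'a set \<Rightarrow> ('a \<Rightarrow> 'a \<Rightarrow> bool) \<Rightarrow> nat \<Rightarrow> bool" where
  "regular_graph V adj d \<longleftrightarrow> (\<forall>u\<in>V. card (neighbours V adj u) = d)"

text \<open>Null space of the adjacency matrix: vectors indexed by the vertices
  (functions, only values on V matter) with A x = 0.\<close>
definition adj_kernel :: "'a set \<Rightarrow> ('a \<Rightarrow> 'a \<Rightarrow> bool) \<Rightarrow> ('a \<Rightarrow> real) set" where
  "adj_kernel V adj = {x. \<forall>u\<in>V. (\<Sum>v\<in>neighbours V adj u. x v) = 0}"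

definition nut_graph :: "'a set \<Rightarrow> ('a \<Rightarrow> 'a \<Rightarrow> bool) \<Rightarrow> bool" where
  "nut_graph V adj \<longleftrightarrow> finite V \<and> card V \<ge> 2 \<and>
     (\<exists>x\<in>adj_kernel V adj. (\<forall>v\<in>V. x v \<noteq> 0) \<and>
        (\<forall>y\<in>adj_kernel V adj. \<exists>c::real. \<forall>v\<in>V. y v = c * x v))"

definition cayley_adj :: "('g, 'b) monoid_scheme \<Rightarrow> 'g set \<Rightarrow> 'g \<Rightarrow> 'g \<Rightarrow> bool" where
  "cayley_adj G C u v \<longleftrightarrow> v \<otimes>\<^bsub>G\<^esub> inv\<^bsub>G\<^esub> u \<in> C"

definition connection_set :: "('g, 'b) monoid_scheme \<Rightarrow> 'g set \<Rightarrow> bool" where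
  "connection_set G C \<longleftrightarrow> C \<subseteq> carrier G - {\<one>\<^bsub>G\<^esub>} \<and> (\<forall>c\<in>C. inv\<^bsub>G\<^esub> c \<in> C)"

definition cyclic_group :: "nat \<Rightarrow> nat monoid" where
  "cyclic_group n = \<lparr>carrier = {0..<n}, mult = (\<lambda>a b. (a + b) mod n), one = 0\<rparr>"

text \<open>Dihedral group of order 2m: the pair (k, b) stands for r^k s^(if b then 1 else 0),
  with r^a s^b * r^c s^e = r^(a + (-1)^b c) s^(b + e).\<close>
definition dihedral_group :: "nat \<Rightarrow> (nat \<times> bool) monoid" where
  "dihedral_group m = \<lparr>carrier = {0..<m} \<times> UNIV,
     mult = (\<lambda>(a, b) (c, e). (if b then (a + m - c) mod m else (a + c) mod m, b \<noteq> e)),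
     one = (0, False)\<rparr>"

end

(* A root of unity z turns the adjacency matrix of the Cayley graph into the number C(z), the sum
   of z^c over the connection set, for a cyclic group, and into a 2 by 2 matrix with determinant
   R(z)^2 - T(z) T(1/z) for a dihedral group, where R and T are the rotations and reflections in
   the connection set. The graph is a nut graph as soon as exactly one character with values 1 and
   -1 spans a line of the kernel and every other irreducible representation is nonsingular. To
   exclude all other zeros, almost all elements of the connection set are taken in cosets of the
   subgroup of order two: at half of the roots of unity these cancel, and at the others they
   contribute a multiple of 2 to the determinant. Up to units and factors 1 + z or 1 - z the
   determinant is then an odd number plus twice a cyclotomic integer, so it does not vanish. *)
theory Submission
  imports Defs "Jordan_Normal_Form.Char_Poly" "HOL-Number_Theory.Cong"
begin

section \<open>Cyclotomic integers\<close>

text \<open>Write \<open>n = 2 * m\<close> and \<open>d = 2 * k\<close>. If \<open>m\<close> is odd,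
  then 4 divides \<open>d\<close>, and the cyclic group works: roots of unity of odd order make
  \<open>z + inverse z\<close> a unit, which the parity argument needs. If \<open>m = 2 * M\<close>,
  the dihedral group of order \<open>n\<close> has the central subgroup formed by \<open>0\<close>
  and \<open>M\<close>. A connection set made of full cosets only would be singular at every
  \<open>z\<close> with \<open>z ^ M = -1\<close>, so a few cosets must be met in one element each.
  These unpaired elements have three duties: at \<open>z ^ M = -1\<close> they alone give a
  determinant that can be factored by hand, at \<open>z ^ M = 1\<close> they supply the odd part,
  and at one of \<open>1\<close> and \<open>-1\<close> they create the zero that makes the graph a
  nut graph. Their number fixes the degree modulo 4 and the room left for full cosets, so each
  combination of parities has its own family, and a few extreme degrees that do not fit are served
  by separate sets.\<close>

lemma power_mod_root_unity:
  fixes z :: "'a :: comm_ring_1"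
  assumes "z ^ m = 1"
  shows "z ^ (k mod m) = z ^ k"
proof -
  have "z ^ k = z ^ (m * (k div m) + k mod m)" by simp
  also have "\<dots> = z ^ (k mod m)"
    unfolding power_add power_mult assms by simp
  finally show ?thesis by simp
qed

text \<open>The ring Z[z]. For a root of unity \<open>z\<close> it contains
  \<open>inverse z\<close>, which is then a power of \<open>z\<close>.\<close>

definition int_adjoin :: "complex \<Rightarrow> complex set" where
  "int_adjoin z = range (\<lambda>p. poly (of_int_poly p) z)"

lemma int_adjoin_of_int [simp, intro]: "of_int k \<in> int_adjoin z"
  unfolding int_adjoin_def by (rule image_eqI [of _ _ "[:k:]"]) (simp_all add: of_int_hom.map_poly_pCons_hom)

lemma int_adjoin_numeral [simp, intro]: "numeral k \<in> int_adjoin z"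
  using int_adjoin_of_int [of "numeral k" z] by simp

lemma int_adjoin_0 [simp, intro]: "0 \<in> int_adjoin z"
  using int_adjoin_of_int [of 0 z] by simp

lemma int_adjoin_1 [simp, intro]: "1 \<in> int_adjoin z"
  using int_adjoin_of_int [of 1 z] by simp

lemma int_adjoin_self [simp, intro]: "z \<in> int_adjoin z"
  unfolding int_adjoin_def by (rule image_eqI [of _ _ "[:0, 1:]"]) (simp_all add: of_int_hom.map_poly_pCons_hom)

lemma int_adjoin_add [intro]:
  assumes "a \<in> int_adjoin z" "b \<in> int_adjoin z"
  shows "a + b \<in> int_adjoin z"
proof -
  obtain p q where "a = poly (of_int_poly p) z" "b = poly (of_int_poly q) z"
    using assms unfolding int_adjoin_def by blast
  then have "a + b = poly (of_int_poly (p + q)) z"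
    by (simp add: of_int_poly_hom.hom_add)
  then show ?thesis unfolding int_adjoin_def by blast
qed

lemma int_adjoin_uminus [intro]:
  assumes "a \<in> int_adjoin z"
  shows "- a \<in> int_adjoin z"
proof -
  obtain p where "a = poly (of_int_poly p) z"
    using assms unfolding int_adjoin_def by blast
  then have "- a = poly (of_int_poly (- p)) z"
    by (simp add: of_int_poly_hom.hom_uminus)
  then show ?thesis unfolding int_adjoin_def by blast
qed

lemma int_adjoin_mult [intro]:
  assumes "a \<in> int_adjoin z" "b \<in> int_adjoin z"
  shows "a * b \<in> int_adjoin z"
proof -
  obtain p q where "a = poly (of_int_poly p) z" "b = poly (of_int_poly q) z"
    using assms unfolding int_adjoin_def by blast
  then have "a * b = poly (of_int_poly (p * q)) z"
    by (simp add: of_int_poly_hom.hom_mult)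
  then show ?thesis unfolding int_adjoin_def by blast
qed

lemma int_adjoin_diff [intro]: "a \<in> int_adjoin z \<Longrightarrow> b \<in> int_adjoin z \<Longrightarrow> a - b \<in> int_adjoin z"
  using int_adjoin_add [OF _ int_adjoin_uminus, of a z b] by simp

lemma int_adjoin_power [intro]: "a \<in> int_adjoin z \<Longrightarrow> a ^ n \<in> int_adjoin z"
  by (induction n) auto

lemma int_adjoin_sum [intro]: "(\<And>i. i \<in> I \<Longrightarrow> f i \<in> int_adjoin z) \<Longrightarrow> sum f I \<in> int_adjoin z"
  by (induction I rule: infinite_finite_induct) auto

lemma inverse_root_unity:
  fixes z :: complex
  assumes "z ^ m = 1" "m > 0"
  shows "inverse z = z ^ (m - 1)"
  using assms by (intro inverse_unique) (simp add: power_eq_if)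

lemma int_adjoin_inverse [intro]:
  assumes "z ^ m = 1" "m > 0"
  shows "inverse z \<in> int_adjoin z"
  unfolding inverse_root_unity [OF assms] by auto

text \<open>Multiplication by an element of the ring is an integer matrix with respect to the powers
  of \<^term>\<open>z\<close>, so the element is a root of its monic characteristic polynomial.\<close>

lemma algebraic_int_int_adjoin:
  fixes z :: complex
  assumes z: "z ^ m = 1" "m > 0" and w: "w \<in> int_adjoin z"
  shows "algebraic_int w"
proof -
  obtain p where p: "w = poly (of_int_poly p) z"
    using w by (auto simp: int_adjoin_def)
  \<comment> \<open>Row \<open>i\<close> expands \<open>w * z ^ i\<close> in the powers of
    \<open>z\<close>, exponents being reduced modulo \<open>m\<close>. The powers may be linearly
    dependent; it suffices that the vector \<open>v\<close> of powers is nonzero and is an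
    eigenvector for \<open>w\<close>.\<close>
  define C :: "int mat" where
    "C = mat m m (\<lambda>(i, j). \<Sum>l\<le>degree p. if (i + l) mod m = j then coeff p l else 0)"
  define v where "v = vec m (\<lambda>j. z ^ j)"
  have C: "C \<in> carrier_mat m m" by (auto simp: C_def)
  let ?C = "map_mat complex_of_int C"
  have wsum: "w = (\<Sum>l\<le>degree p. of_int (coeff p l) * z ^ l)"
    unfolding p by (simp add: poly_altdef)
  have "?C *\<^sub>v v = w \<cdot>\<^sub>v v"
  proof (rule eq_vecI)
    fix i assume "i < dim_vec (w \<cdot>\<^sub>v v)"
    then have i: "i < m" by (simp add: v_def)
    have "(?C *\<^sub>v v) $ i = (\<Sum>j<m. of_int (\<Sum>l\<le>degree p. if (i + l) mod m = j then coeff p l else 0) * z ^ j)"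
      using i by (simp add: C_def v_def scalar_prod_def atLeast0LessThan)
    also have "\<dots> = (\<Sum>j<m. \<Sum>l\<le>degree p. if (i + l) mod m = j then of_int (coeff p l) * z ^ j else 0)"
      unfolding of_int_sum sum_distrib_right by (intro sum.cong refl) simp
    also have "\<dots> = (\<Sum>l\<le>degree p. \<Sum>j<m. if (i + l) mod m = j then of_int (coeff p l) * z ^ j else 0)"
      by (rule sum.swap)
    also have "\<dots> = (\<Sum>l\<le>degree p. of_int (coeff p l) * z ^ (i + l))"
      using z(2) by (intro sum.cong refl) (simp add: power_mod_root_unity [OF z(1)])
    also have "\<dots> = w * z ^ i"
      unfolding wsum by (simp add: sum_distrib_left power_add mult_ac)
    finally show "(?C *\<^sub>v v) $ i = (w \<cdot>\<^sub>v v) $ i"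
      using i by (simp add: v_def)
  qed (auto simp: v_def C_def)
  moreover have "v \<noteq> 0\<^sub>v m"
  proof
    assume "v = 0\<^sub>v m"
    then have "v $ 0 = 0\<^sub>v m $ 0" by simp
    then show False using z(2) by (simp add: v_def)
  qed
  ultimately have "eigenvalue ?C w"
    unfolding eigenvalue_def eigenvector_def using C
    by (intro exI [of _ v]) (simp add: v_def)
  then have "poly (char_poly ?C) w = 0"
    using eigenvalue_root_char_poly [of ?C m w] C by simp
  then have root: "poly (of_int_poly (char_poly C)) w = 0"
    by (simp only: of_int_hom.char_poly_hom [OF C])
  have lead: "lead_coeff (char_poly C) = 1"
    using degree_monic_char_poly [OF C] by simp
  show ?thesis
    unfolding algebraic_int_altdef_ipoly by (rule exI, rule conjI, rule root, rule lead)
qed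

text \<open>Half of an odd integer is rational but not an integer, hence not an algebraic integer.
  Every parity argument below ends here: an equation "odd integer plus twice a ring element is
  zero", possibly after multiplication by units, is impossible.\<close>

lemma even_not_odd_int_adjoin:
  fixes z :: complex
  assumes z: "z ^ m = 1" "m > 0" and w: "w \<in> int_adjoin z" and "odd k"
  shows "2 * w \<noteq> of_int k"
proof
  assume eq: "2 * w = of_int k"
  then have "w = of_int k / 2" by (simp add: field_simps)
  then have "w \<in> \<rat>" by (metis Rats_divide Rats_number_of Rats_of_int)
  then have "w \<in> \<int>"
    using algebraic_int_int_adjoin [OF z w] rational_algebraic_int_is_int by blast
  then obtain l where "w = of_int l" by (auto elim: Ints_cases)
  with eq have "of_int (2 * l) = (of_int k :: complex)" by simp
  then have "2 * l = k" by (simp only: of_int_eq_iff)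
  with \<open>odd k\<close> show False by auto
qed

section \<open>Vectors with a single Fourier coefficient\<close>

text \<open>Fourier inversion by counting roots: after subtraction of a multiple of the geometric
  progression with ratio \<open>inverse e\<close>, the generating polynomial has degree below
  \<open>m\<close> and vanishes at all \<open>m\<close> roots of unity.\<close>

lemma single_fourier_coefficient:
  fixes f :: "nat \<Rightarrow> complex"
  assumes "m > 0" and e: "e ^ m = 1"
    and vanish: "\<And>z. z ^ m = 1 \<Longrightarrow> z \<noteq> e \<Longrightarrow> (\<Sum>i<m. f i * z ^ i) = 0"
    and "i < m"
  shows "f i = f 0 * inverse e ^ i"
proof -
  \<comment> \<open>This value makes \<open>q\<close> vanish at \<open>e\<close> as well, where the
    subtracted geometric sum equals \<open>m\<close>.\<close>
  define c where "c = (\<Sum>i<m. f i * e ^ i) / of_nat m"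
  define q where "q = (\<Sum>i<m. monom (f i - c * inverse e ^ i) i)"
  have e0: "e \<noteq> 0" using e \<open>m > 0\<close> by (auto simp: power_0_left)
  have pq: "poly q z = (\<Sum>i<m. f i * z ^ i) - c * (\<Sum>i<m. (z / e) ^ i)" for z
  proof -
    have "poly q z = (\<Sum>i<m. f i * z ^ i - c * (z / e) ^ i)"
      unfolding q_def poly_sum poly_monom
      by (intro sum.cong refl) (simp add: algebra_simps power_mult_distrib divide_inverse)
    then show ?thesis by (simp add: sum_subtractf sum_distrib_left)
  qed
  have "poly q z = 0" if z: "z ^ m = 1" for z
  proof (cases "z = e")
    case True
    then have "(\<Sum>i<m. (z / e) ^ i) = of_nat m" using e0 by simp
    then show ?thesis using True \<open>m > 0\<close> by (simp add: pq c_def)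
  next
    case False
    then have "(\<Sum>i<m. (z / e) ^ i) = 0"
      using e0 e z by (subst geometric_sum) (simp_all add: power_divide)
    then show ?thesis using vanish [OF z False] by (simp add: pq)
  qed
  then have sub: "{z. z ^ m = 1} \<subseteq> {z. poly q z = 0}" by auto
  have cq: "coeff q k = (if k < m then f k - c * inverse e ^ k else 0)" for k
    by (simp add: q_def coeff_sum)
  have "q = 0"
  proof (rule ccontr)
    assume "q \<noteq> 0"
    then have "coeff q (degree q) \<noteq> 0" by simp
    then have deg: "degree q < m" unfolding cq by (rule contrapos_np) simp
    have "m = card {z :: complex. z ^ m = 1}"
      using card_roots_unity_eq [of m] \<open>m > 0\<close> by simp
    also have "\<dots> \<le> card {z. poly q z = 0}"
      using poly_roots_finite [OF \<open>q \<noteq> 0\<close>] sub by (rule card_mono)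
    also have "\<dots> \<le> degree q"
      using \<open>q \<noteq> 0\<close> by (rule card_poly_roots_bound)
    finally show False using deg by simp
  qed
  then have "f k = c * inverse e ^ k" if "k < m" for k
    using cq [of k] that by simp
  from this [of i] this [of 0] show ?thesis using \<open>i < m\<close> by simp
qed

text \<open>For \<open>z ^ m = 1\<close> this is the sum over \<open>S\<close> of a character of the
  integers modulo \<open>m\<close>.\<close>

definition power_sum :: "nat set \<Rightarrow> complex \<Rightarrow> complex" where
  "power_sum S z = (\<Sum>s\<in>S. z ^ s)"

lemma int_adjoin_power_sum [intro]: "w \<in> int_adjoin z \<Longrightarrow> power_sum S w \<in> int_adjoin z"
  unfolding power_sum_def by (intro int_adjoin_sum int_adjoin_power)

lemma fourier_translate:
  fixes z :: complex
  assumes z: "z ^ m = 1" "m > 0"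
  shows "(\<Sum>i<m. f ((r + i) mod m) * z ^ i) = inverse z ^ r * (\<Sum>i<m. f i * z ^ i)"
proof -
  have z0: "z \<noteq> 0" using z by (auto simp: power_0_left)
  have inj: "inj_on (\<lambda>i. (r + i) mod m) {..<m}"
  proof (rule inj_onI)
    fix i j assume *: "i \<in> {..<m}" "j \<in> {..<m}" "(r + i) mod m = (r + j) mod m"
    then have "[i = j] (mod m)" by (simp only: cong_def [symmetric] cong_add_lcancel_nat)
    then show "i = j" using * by (simp add: cong_def)
  qed
  have img: "(\<lambda>i. (r + i) mod m) ` {..<m} = {..<m}"
    using z(2) inj by (intro endo_inj_surj) (simp_all add: image_subset_iff)
  have "(\<Sum>i<m. f ((r + i) mod m) * z ^ i)
      = (\<Sum>i<m. inverse z ^ r * (f ((r + i) mod m) * z ^ ((r + i) mod m)))"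
    unfolding power_mod_root_unity [OF z(1)]
    using z0 by (intro sum.cong refl) (simp add: power_add power_inverse)
  also have "\<dots> = inverse z ^ r * (\<Sum>i\<in>(\<lambda>i. (r + i) mod m) ` {..<m}. f i * z ^ i)"
    by (simp add: sum_distrib_left sum.reindex [OF inj] o_def)
  finally show ?thesis unfolding img .
qed

text \<open>The substitution of \<open>t - i\<close> for \<open>i\<close> replaces \<open>z\<close>
  by its inverse; this is why reflections couple the Fourier coefficients at \<open>z\<close> and at
  \<open>inverse z\<close>. The summand \<open>m\<close> keeps the subtraction of naturals from
  truncating.\<close>

lemma fourier_reflect:
  fixes z :: complex
  assumes z: "z ^ m = 1" "m > 0"
  shows "(\<Sum>i<m. f ((t + m - i) mod m) * z ^ i) = z ^ t * (\<Sum>i<m. f i * inverse z ^ i)"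
proof -
  have z0: "z \<noteq> 0" using z by (auto simp: power_0_left)
  have iz: "inverse z ^ m = 1" using z by (simp add: power_inverse)
  have zi: "z ^ i = z ^ t * inverse z ^ ((t + m - i) mod m)" if "i < m" for i
  proof -
    have "inverse z ^ ((t + m - i) mod m) * z ^ t = inverse z ^ (t + m - i) * z ^ t"
      by (simp only: power_mod_root_unity [OF iz])
    also have "\<dots> = inverse z ^ (t + m - i) * inverse z ^ i * z ^ i * z ^ t"
      using z0 by (simp add: power_inverse)
    also have "inverse z ^ (t + m - i) * inverse z ^ i = inverse z ^ (t + m)"
      using that by (simp flip: power_add)
    also have "inverse z ^ (t + m) * z ^ i * z ^ t = z ^ i"
      using z0 iz by (simp add: power_add power_inverse)
    finally show ?thesis by (simp add: mult.commute)
  qed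
  have inj: "inj_on (\<lambda>i. (t + m - i) mod m) {..<m}"
  proof (rule inj_onI)
    fix i j assume *: "i \<in> {..<m}" "j \<in> {..<m}" "(t + m - i) mod m = (t + m - j) mod m"
    then have "[t + m - i + (i + j) = t + m - j + (i + j)] (mod m)"
      using *(3) by (intro cong_add) (simp_all add: cong_def)
    moreover have "t + m - i + (i + j) = (t + m) + j" "t + m - j + (i + j) = (t + m) + i"
      using * by auto
    ultimately have "[j = i] (mod m)"
      by (simp only: cong_add_lcancel_nat cong_sym_eq)
    then show "i = j" using * by (simp add: cong_def)
  qed
  have img: "(\<lambda>i. (t + m - i) mod m) ` {..<m} = {..<m}"
    using z(2) inj by (intro endo_inj_surj) (simp_all add: image_subset_iff)
  have "(\<Sum>i<m. f ((t + m - i) mod m) * z ^ i)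
      = (\<Sum>i<m. z ^ t * (f ((t + m - i) mod m) * inverse z ^ ((t + m - i) mod m)))"
  proof (intro sum.cong refl)
    fix i assume "i \<in> {..<m}"
    then have "z ^ i = z ^ t * inverse z ^ ((t + m - i) mod m)" using zi by simp
    then show "f ((t + m - i) mod m) * z ^ i
      = z ^ t * (f ((t + m - i) mod m) * inverse z ^ ((t + m - i) mod m))"
      by (simp only: mult_ac)
  qed
  also have "\<dots> = z ^ t * (\<Sum>i\<in>(\<lambda>i. (t + m - i) mod m) ` {..<m}. f i * inverse z ^ i)"
    by (simp add: sum_distrib_left sum.reindex [OF inj] o_def)
  finally show ?thesis unfolding img .
qed

section \<open>A spectral criterion for Cayley graphs of cyclic groups\<close>

text \<open>The four shapes that the rotation exponent of a quotient of two vertices takes,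
  according to which of them are reflections, each solved for the neighbour
  \<open>j\<close>.\<close>

lemma add_mod_iff:
  fixes n :: nat
  assumes "i < n" "j < n" "c < n"
  shows "(j + (n - i) mod n) mod n = c \<longleftrightarrow> j = (c + i) mod n"
    and "(j + n - i) mod n = c \<longleftrightarrow> j = (c + i) mod n"
    and "(j + n - (n - i) mod n) mod n = c \<longleftrightarrow> j = (c + n - i) mod n"
    and "(j + i) mod n = c \<longleftrightarrow> j = (c + n - i) mod n"
  using assms by (auto simp: mod_if split: if_splits)

lemma inj_on_rotate: "inj_on (\<lambda>r. (r + i) mod m) {0..<m::nat}"
proof (rule inj_onI)
  fix r s assume *: "r \<in> {0..<m}" "s \<in> {0..<m}" "(r + i) mod m = (s + i) mod m"
  then have "[r = s] (mod m)" by (simp only: cong_def [symmetric] cong_add_rcancel_nat)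
  then show "r = s" using * by (simp add: cong_def)
qed

lemma inj_on_reflect: "i < m \<Longrightarrow> inj_on (\<lambda>t. (t + m - i) mod m) {0..<m::nat}"
  using inj_on_rotate [of "m - i" m] by simp

definition cyclic_nut :: "nat \<Rightarrow> nat \<Rightarrow> bool" where
  "cyclic_nut n d \<longleftrightarrow> (\<exists>C. connection_set (cyclic_group n) C \<and>
     card (carrier (cyclic_group n)) = n \<and>
     regular_graph (carrier (cyclic_group n)) (cayley_adj (cyclic_group n) C) d \<and>
     nut_graph (carrier (cyclic_group n)) (cayley_adj (cyclic_group n) C))"

lemma carrier_cyclic_group [simp]: "carrier (cyclic_group n) = {0..<n}"
  by (simp add: cyclic_group_def)

lemma inv_cyclic_group:
  assumes "k < n"
  shows "inv\<^bsub>cyclic_group n\<^esub> k = (n - k) mod n"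
  unfolding m_inv_def
proof (rule the_equality)
  show "(n - k) mod n \<in> carrier (cyclic_group n) \<and>
    k \<otimes>\<^bsub>cyclic_group n\<^esub> ((n - k) mod n) = \<one>\<^bsub>cyclic_group n\<^esub> \<and>
    ((n - k) mod n) \<otimes>\<^bsub>cyclic_group n\<^esub> k = \<one>\<^bsub>cyclic_group n\<^esub>"
    using assms by (simp add: cyclic_group_def mod_simps)
next
  fix y assume "y \<in> carrier (cyclic_group n) \<and>
    k \<otimes>\<^bsub>cyclic_group n\<^esub> y = \<one>\<^bsub>cyclic_group n\<^esub> \<and> y \<otimes>\<^bsub>cyclic_group n\<^esub> k = \<one>\<^bsub>cyclic_group n\<^esub>"
  then show "y = (n - k) mod n"
    using assms by (auto simp: cyclic_group_def mod_if split: if_splits)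
qed

lemma neighbours_cyclic:
  assumes "C \<subseteq> {0..<n}" "i < n"
  shows "neighbours {0..<n} (cayley_adj (cyclic_group n) C) i
    = (\<lambda>c. (c + i) mod n) ` C" (is "?L = ?R")
proof -
  have "j \<in> ?L \<longleftrightarrow> j \<in> ?R" for j
  proof (cases "j < n")
    case True
    have "j \<in> ?L \<longleftrightarrow> (j + (n - i) mod n) mod n \<in> C"
      using assms True
      by (simp add: neighbours_def cayley_adj_def inv_cyclic_group) (simp add: cyclic_group_def)
    also have "\<dots> \<longleftrightarrow> (\<exists>c\<in>C. (j + (n - i) mod n) mod n = c)" by simp
    also have "\<dots> \<longleftrightarrow> (\<exists>c\<in>C. j = (c + i) mod n)"
      using assms True by (intro bex_cong refl add_mod_iff(1)) auto
    also have "\<dots> \<longleftrightarrow> j \<in> ?R" by auto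
    finally show ?thesis .
  qed (use assms in \<open>auto simp: neighbours_def cyclic_group_def\<close>)
  then show ?thesis by blast
qed

lemma power_sum_inverse:
  assumes S: "S \<subseteq> {0<..<m}" "\<And>s. s \<in> S \<Longrightarrow> m - s \<in> S" and z: "z ^ m = 1" "m > 0"
  shows "power_sum S (inverse z) = power_sum S z"
  unfolding power_sum_def
proof (rule sum.reindex_bij_witness [of _ "\<lambda>s. m - s" "\<lambda>s. m - s"])
  fix s assume "s \<in> S"
  then have "s < m" using S(1) by auto
  then have "z ^ (m - s) * z ^ s = 1" using z(1) by (simp flip: power_add)
  then show "z ^ (m - s) = inverse z ^ s"
    by (metis inverse_unique mult.commute power_inverse)
qed (use S in auto)

lemma cyclic_nutI:
  assumes "n \<ge> 2" "even n" and C: "C \<subseteq> {0<..<n}" "\<And>c. c \<in> C \<Longrightarrow> n - c \<in> C"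
    and minus: "power_sum C (-1) = 0"
    and nonzero: "\<And>z. z ^ n = 1 \<Longrightarrow> z \<noteq> -1 \<Longrightarrow> power_sum C z \<noteq> 0"
  shows "cyclic_nut n (card C)"
proof -
  let ?G = "cyclic_group n" and ?V = "{0..<n}"
  have n0: "n > 0" and C': "C \<subseteq> {0..<n}" using assms by auto
  have inj: "inj_on (\<lambda>c. (c + i) mod n) C" for i
    using inj_on_rotate C' by (rule inj_on_subset)
  have ker: "y \<in> adj_kernel (?V) (cayley_adj ?G C)
      \<longleftrightarrow> (\<forall>i<n. (\<Sum>c\<in>C. y ((c + i) mod n)) = 0)" for y
    using C' by (simp add: adj_kernel_def neighbours_cyclic sum.reindex [OF inj] Ball_def)
  have e: "(-1) ^ n = (1::'a::comm_ring_1)" using \<open>even n\<close> by simp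
  have "complex_of_real (\<Sum>c\<in>C. (-1) ^ c) = 0"
    using minus by (simp add: power_sum_def)
  then have minus': "(\<Sum>c\<in>C. (-1::real) ^ c) = 0"
    by (simp only: of_real_eq_0_iff)
  have "nut_graph (?V) (cayley_adj ?G C)"
    unfolding nut_graph_def
  proof (intro conjI bexI [of _ "\<lambda>i. (-1) ^ i"])
    show "(\<lambda>i. (-1) ^ i) \<in> adj_kernel (?V) (cayley_adj ?G C)"
      unfolding ker power_mod_root_unity [OF e]
      using minus' by (simp add: power_add flip: sum_distrib_right)
    show "\<forall>y\<in>adj_kernel (?V) (cayley_adj ?G C). \<exists>c. \<forall>v\<in>?V. y v = c * (-1) ^ v"
    proof
      fix y assume "y \<in> adj_kernel (?V) (cayley_adj ?G C)"
      then have y: "(\<Sum>c\<in>C. y ((c + i) mod n)) = 0" if "i < n" for i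
        using that by (simp add: ker)
      define F where "F z = (\<Sum>i<n. complex_of_real (y i) * z ^ i)" for z
      \<comment> \<open>The Fourier transform turns the kernel equations, which are convolutions
        with \<open>C\<close>, into products; the symmetry of \<open>C\<close> removes the
        inverse.\<close>
      have F0: "F z = 0" if z: "z ^ n = 1" "z \<noteq> -1" for z
      proof -
        have "0 = (\<Sum>i<n. complex_of_real (\<Sum>c\<in>C. y ((c + i) mod n)) * z ^ i)"
          using y by simp
        also have "\<dots> = (\<Sum>i<n. \<Sum>c\<in>C. complex_of_real (y ((c + i) mod n)) * z ^ i)"
          by (simp add: sum_distrib_right)
        also have "\<dots> = (\<Sum>c\<in>C. \<Sum>i<n. complex_of_real (y ((c + i) mod n)) * z ^ i)"
          by (rule sum.swap)
        also have "\<dots> = (\<Sum>c\<in>C. inverse z ^ c * F z)"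
          unfolding F_def using z n0
          by (intro sum.cong refl fourier_translate [where f = "\<lambda>i. complex_of_real (y i)"])
        also have "\<dots> = power_sum C (inverse z) * F z"
          by (simp add: power_sum_def sum_distrib_right)
        also have "power_sum C (inverse z) = power_sum C z"
          using C z(1) n0 by (rule power_sum_inverse)
        finally show ?thesis using nonzero [OF z] by simp
      qed
      have "y i = y 0 * (-1) ^ i" if "i < n" for i
      proof -
        have "complex_of_real (y i) = complex_of_real (y 0) * inverse (-1) ^ i"
          using n0 e F0 that unfolding F_def by (rule single_fourier_coefficient)
        also have "\<dots> = complex_of_real (y 0 * (-1) ^ i)" by simp
        finally show ?thesis by (simp only: of_real_eq_iff)
      qed
      then show "\<exists>c. \<forall>v\<in>?V. y v = c * (-1) ^ v"
        by (intro exI [of _ "y 0"]) (simp only: atLeastLessThan_iff Ball_def, blast)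
    qed
  qed (use \<open>n \<ge> 2\<close> in \<open>auto simp: cyclic_group_def\<close>)
  moreover have "regular_graph (?V) (cayley_adj ?G C) (card C)"
    unfolding regular_graph_def
  proof
    fix i assume "i \<in> ?V"
    then have "i < n" by (simp add: cyclic_group_def)
    then show "card (neighbours (?V) (cayley_adj ?G C) i) = card C"
      using C' by (simp add: neighbours_cyclic card_image [OF inj])
  qed
  moreover have "connection_set ?G C"
    unfolding connection_set_def carrier_cyclic_group
  proof (intro conjI ballI)
    show "C \<subseteq> ?V - {\<one>\<^bsub>?G\<^esub>}" using C by (auto simp: cyclic_group_def)
    fix c assume "c \<in> C"
    then have "n - c \<in> C" "0 < c" "c < n" using C by auto
    then show "inv\<^bsub>?G\<^esub> c \<in> C" by (simp add: inv_cyclic_group)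
  qed
  ultimately show ?thesis
    unfolding cyclic_nut_def carrier_cyclic_group by (intro exI [of _ C]) simp
qed

section \<open>A spectral criterion for Cayley graphs of dihedral groups\<close>

definition dihedral_nut :: "nat \<Rightarrow> nat \<Rightarrow> bool" where
  "dihedral_nut m d \<longleftrightarrow> (\<exists>C. connection_set (dihedral_group m) C \<and>
     card (carrier (dihedral_group m)) = 2 * m \<and>
     regular_graph (carrier (dihedral_group m)) (cayley_adj (dihedral_group m) C) d \<and>
     nut_graph (carrier (dihedral_group m)) (cayley_adj (dihedral_group m) C))"

lemma carrier_dihedral_group [simp]: "carrier (dihedral_group m) = {0..<m} \<times> UNIV"
  by (simp add: dihedral_group_def)

lemma inv_dihedral_group:
  assumes "k < m"
  shows "inv\<^bsub>dihedral_group m\<^esub> (k, b) = (if b then k else (m - k) mod m, b)"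
  unfolding m_inv_def
proof (rule the_equality)
  let ?y = "(if b then k else (m - k) mod m, b)"
  show "?y \<in> carrier (dihedral_group m) \<and>
    (k, b) \<otimes>\<^bsub>dihedral_group m\<^esub> ?y = \<one>\<^bsub>dihedral_group m\<^esub> \<and>
    ?y \<otimes>\<^bsub>dihedral_group m\<^esub> (k, b) = \<one>\<^bsub>dihedral_group m\<^esub>"
    using assms
    by (cases b) (simp_all add: dihedral_group_def mod_add_left_eq mod_add_right_eq)
next
  fix y assume "y \<in> carrier (dihedral_group m) \<and>
    (k, b) \<otimes>\<^bsub>dihedral_group m\<^esub> y = \<one>\<^bsub>dihedral_group m\<^esub> \<and>
    y \<otimes>\<^bsub>dihedral_group m\<^esub> (k, b) = \<one>\<^bsub>dihedral_group m\<^esub>"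
  then show "y = (if b then k else (m - k) mod m, b)"
    using assms by (cases y; cases b) (auto simp: dihedral_group_def mod_if split: if_splits)
qed

text \<open>The neighbours of a vertex are its left multiples by the connection set. A rotation
  shifts the exponent and a reflection reverses it, which gives \<open>t - i\<close> and flips the
  second component.\<close>

lemma neighbours_dihedral:
  assumes "R \<subseteq> {0..<m}" "T \<subseteq> {0..<m}" "i < m"
  shows "neighbours ({0..<m} \<times> UNIV)
      (cayley_adj (dihedral_group m) (R \<times> {False} \<union> T \<times> {True})) (i, b)
    = (\<lambda>r. ((r + i) mod m, b)) ` R \<union> (\<lambda>t. ((t + m - i) mod m, \<not> b)) ` T" (is "?L = ?R")
proof -
  have bex: "k \<in> S \<longleftrightarrow> (\<exists>c\<in>S. j = g c)"
    if "\<And>c. c < m \<Longrightarrow> k = c \<longleftrightarrow> j = g c" "S \<subseteq> {0..<m}" for g :: "nat \<Rightarrow> nat" and j k S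
  proof -
    have "k \<in> S \<longleftrightarrow> (\<exists>c\<in>S. k = c)" by simp
    also have "\<dots> \<longleftrightarrow> (\<exists>c\<in>S. j = g c)"
      using that(2) by (intro bex_cong refl that(1)) auto
    finally show ?thesis .
  qed
  have "(j, c) \<in> ?L \<longleftrightarrow> (j, c) \<in> ?R" for j c
  proof (cases "j < m")
    case True
    have "(j, c) \<in> ?L \<longleftrightarrow> (if b = c
      then (if c then (j + m - i) mod m else (j + (m - i) mod m) mod m) \<in> R
      else (if c then (j + m - (m - i) mod m) mod m else (j + i) mod m) \<in> T)"
      using assms True
      by (simp add: neighbours_def cayley_adj_def inv_dihedral_group)
        (auto simp: dihedral_group_def)
    also have "\<dots> \<longleftrightarrow> (if b = c then (\<exists>r\<in>R. j = (r + i) mod m) else (\<exists>t\<in>T. j = (t + m - i) mod m))"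
      using bex [OF add_mod_iff(2) [OF assms(3) True] assms(1)]
        bex [OF add_mod_iff(1) [OF assms(3) True] assms(1)]
        bex [OF add_mod_iff(3) [OF assms(3) True] assms(2)]
        bex [OF add_mod_iff(4) [OF assms(3) True] assms(2)]
      by simp
    also have "\<dots> \<longleftrightarrow> (j, c) \<in> ?R" by auto
    finally show ?thesis .
  qed (use assms in \<open>auto simp: neighbours_def\<close>)
  then show ?thesis by auto
qed

lemma sum_neighbours_dihedral:
  assumes "R \<subseteq> {0..<m}" "T \<subseteq> {0..<m}" "i < m"
  shows "sum y (neighbours ({0..<m} \<times> UNIV)
      (cayley_adj (dihedral_group m) (R \<times> {False} \<union> T \<times> {True})) (i, b))
    = (\<Sum>r\<in>R. y ((r + i) mod m, b)) + (\<Sum>t\<in>T. y ((t + m - i) mod m, \<not> b))"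
proof -
  have fin: "finite R" "finite T"
    using assms(1,2) finite_subset [OF _ finite_atLeastLessThan] by blast+
  have R: "inj_on (\<lambda>r. ((r + i) mod m, b)) R"
    using inj_on_subset [OF inj_on_rotate assms(1), of i] by (simp add: inj_on_def)
  have T: "inj_on (\<lambda>t. ((t + m - i) mod m, \<not> b)) T"
    using inj_on_subset [OF inj_on_reflect [OF assms(3)] assms(2)] by (simp add: inj_on_def)
  have "(\<lambda>r. ((r + i) mod m, b)) ` R \<inter> (\<lambda>t. ((t + m - i) mod m, \<not> b)) ` T = {}"
    by auto
  then show ?thesis
    unfolding neighbours_dihedral [OF assms]
    by (simp add: sum.union_disjoint fin sum.reindex [OF R] sum.reindex [OF T])
qed

text \<open>At a root of unity \<^term>\<open>z\<close> the adjacency operator acts on the pair of Fourier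
  coefficients of a vector as a 2 by 2 matrix with determinant
  \<^term>\<open>power_sum R z * power_sum R z - power_sum T z * power_sum T (inverse z)\<close>.\<close>

lemma dihedral_nutI:
  fixes e s :: real
  assumes "m \<ge> 1" and R: "R \<subseteq> {0<..<m}" "\<And>r. r \<in> R \<Longrightarrow> m - r \<in> R"
    and T: "T \<subseteq> {0..<m}"
    and e: "e = 1 \<or> e = -1" "e ^ m = 1" and s: "s = 1 \<or> s = -1"
    and sing: "power_sum R (of_real e) + of_real s * power_sum T (of_real e) = 0"
    and T0: "power_sum T (of_real e) \<noteq> 0"
    and det: "\<And>z. z ^ m = 1 \<Longrightarrow> z \<noteq> of_real e \<Longrightarrow>
      power_sum R z * power_sum R z \<noteq> power_sum T z * power_sum T (inverse z)"
  shows "dihedral_nut m (card R + card T)"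
proof -
  let ?G = "dihedral_group m" and ?V = "{0..<m} \<times> (UNIV :: bool set)" and ?C = "R \<times> {False} \<union> T \<times> {True}"
  have m0: "m > 0" and R': "R \<subseteq> {0..<m}" using assms by auto
  have ker: "y \<in> adj_kernel (?V) (cayley_adj ?G ?C)
      \<longleftrightarrow> (\<forall>i<m. \<forall>b. (\<Sum>r\<in>R. y ((r + i) mod m, b)) + (\<Sum>t\<in>T. y ((t + m - i) mod m, \<not> b)) = 0)" for y
    by (simp add: adj_kernel_def Ball_def sum_neighbours_dihedral [OF R' T])
  have e0: "e \<noteq> 0" "e * e = 1" and ss: "s * s = 1" using e s by auto
  have eC: "complex_of_real e ^ m = 1" using e(2) by (metis of_real_1 of_real_power)
  have "complex_of_real ((\<Sum>r\<in>R. e ^ r) + s * (\<Sum>t\<in>T. e ^ t)) = 0"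
    using sing by (simp add: power_sum_def)
  then have sing': "(\<Sum>r\<in>R. e ^ r) + s * (\<Sum>t\<in>T. e ^ t) = 0"
    by (simp only: of_real_eq_0_iff)
  have "complex_of_real (\<Sum>t\<in>T. e ^ t) \<noteq> 0"
    using T0 by (simp add: power_sum_def)
  then have T0': "(\<Sum>t\<in>T. e ^ t) \<noteq> 0" by (metis of_real_0)
  have erefl: "e ^ (t + m - i) = e ^ t * e ^ i" if "i < m" for t i
  proof -
    have "e ^ (t + m - i) = e ^ (t + m - i) * (e * e) ^ i" using e0 by simp
    also have "\<dots> = e ^ (t + m - i + i) * e ^ i" by (simp add: power_add power_mult_distrib)
    also have "\<dots> = e ^ t * e ^ i" using that e(2) by (simp add: power_add)
    finally show ?thesis .
  qed
  \<comment> \<open>The one-dimensional character sending the generating rotation to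
    \<open>e\<close> and the reflection to \<open>s\<close>.\<close>
  define x where "x = (\<lambda>(i, b). e ^ i * (if b then s else 1))"
  have "nut_graph (?V) (cayley_adj ?G ?C)"
    unfolding nut_graph_def
  proof (intro conjI bexI [of _ x])
    show "x \<in> adj_kernel (?V) (cayley_adj ?G ?C)"
      unfolding ker
    proof (intro allI impI)
      fix i b assume "i < m"
      have "(\<Sum>r\<in>R. x ((r + i) mod m, b)) + (\<Sum>t\<in>T. x ((t + m - i) mod m, \<not> b))
        = e ^ i * (if b then s else 1) * ((\<Sum>r\<in>R. e ^ r) + s * (\<Sum>t\<in>T. e ^ t))"
        using ss by (cases b) (simp_all add: x_def power_mod_root_unity [OF e(2)] erefl [OF \<open>i < m\<close>]
            power_add distrib_left mult_ac flip: sum_distrib_left sum_distrib_right)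
      then show "(\<Sum>r\<in>R. x ((r + i) mod m, b)) + (\<Sum>t\<in>T. x ((t + m - i) mod m, \<not> b)) = 0"
        by (simp add: sing')
    qed
    show "\<forall>v\<in>?V. x v \<noteq> 0" using e0 s by (auto simp: x_def)
    show "\<forall>y\<in>adj_kernel (?V) (cayley_adj ?G ?C). \<exists>c. \<forall>v\<in>?V. y v = c * x v"
    proof
      fix y assume "y \<in> adj_kernel (?V) (cayley_adj ?G ?C)"
      then have y: "(\<Sum>r\<in>R. y ((r + i) mod m, b)) + (\<Sum>t\<in>T. y ((t + m - i) mod m, \<not> b)) = 0"
        if "i < m" for i b
        using that by (simp add: ker)
      define F where "F b z = (\<Sum>i<m. complex_of_real (y (i, b)) * z ^ i)" for b z
      have FF: "power_sum R z * F b z + power_sum T z * F (\<not> b) (inverse z) = 0"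
        if z: "z ^ m = 1" for z b
      proof -
        have "0 = (\<Sum>i<m. complex_of_real ((\<Sum>r\<in>R. y ((r + i) mod m, b))
            + (\<Sum>t\<in>T. y ((t + m - i) mod m, \<not> b))) * z ^ i)"
          using y by simp
        also have "\<dots> = (\<Sum>i<m. \<Sum>r\<in>R. complex_of_real (y ((r + i) mod m, b)) * z ^ i)
            + (\<Sum>i<m. \<Sum>t\<in>T. complex_of_real (y ((t + m - i) mod m, \<not> b)) * z ^ i)"
          by (simp add: sum_distrib_right distrib_right sum.distrib)
        also have "(\<Sum>i<m. \<Sum>r\<in>R. complex_of_real (y ((r + i) mod m, b)) * z ^ i)
            = (\<Sum>r\<in>R. \<Sum>i<m. complex_of_real (y ((r + i) mod m, b)) * z ^ i)"
          by (rule sum.swap)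
        also have "\<dots> = (\<Sum>r\<in>R. inverse z ^ r * F b z)"
          unfolding F_def using z m0
          by (intro sum.cong refl fourier_translate [where f = "\<lambda>i. complex_of_real (y (i, b))"])
        also have "(\<Sum>i<m. \<Sum>t\<in>T. complex_of_real (y ((t + m - i) mod m, \<not> b)) * z ^ i)
            = (\<Sum>t\<in>T. \<Sum>i<m. complex_of_real (y ((t + m - i) mod m, \<not> b)) * z ^ i)"
          by (rule sum.swap)
        also have "\<dots> = (\<Sum>t\<in>T. z ^ t * F (\<not> b) (inverse z))"
          unfolding F_def using z m0
          by (intro sum.cong refl fourier_reflect [where f = "\<lambda>i. complex_of_real (y (i, \<not> b))"])
        also have "(\<Sum>r\<in>R. inverse z ^ r * F b z) = power_sum R (inverse z) * F b z"
          by (simp add: power_sum_def sum_distrib_right)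
        also have "power_sum R (inverse z) = power_sum R z"
          using R z m0 by (rule power_sum_inverse)
        also have "(\<Sum>t\<in>T. z ^ t * F (\<not> b) (inverse z)) = power_sum T z * F (\<not> b) (inverse z)"
          by (simp add: power_sum_def sum_distrib_right)
        finally show ?thesis by simp
      qed
      have F0: "F b z = 0" if z: "z ^ m = 1" "z \<noteq> of_real e" for z b
      proof -
        let ?r = "power_sum R z"
        have iz: "inverse z ^ m = 1" using z by (simp add: power_inverse)
        have ri: "power_sum R (inverse z) = ?r"
          using R z(1) m0 by (rule power_sum_inverse)
        have 1: "?r * F b z = - (power_sum T z * F (\<not> b) (inverse z))"
          using FF [OF z(1), of b] by (simp add: eq_neg_iff_add_eq_0)
        have 2: "?r * F (\<not> b) (inverse z) = - (power_sum T (inverse z) * F b z)"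
          using FF [OF iz, of "\<not> b"] ri by (simp add: eq_neg_iff_add_eq_0)
        \<comment> \<open>Elimination of the coefficient at \<open>inverse z\<close>, as in Cramer's
          rule, leaves the determinant times \<open>F b z\<close>.\<close>
        have "?r * (?r * F b z) = - (power_sum T z * (?r * F (\<not> b) (inverse z)))"
          unfolding 1 by (simp add: mult_ac)
        then have "?r * (?r * F b z) = power_sum T z * (power_sum T (inverse z) * F b z)"
          unfolding 2 by simp
        then have "(?r * ?r - power_sum T z * power_sum T (inverse z)) * F b z = 0"
          by (simp add: algebra_simps)
        then show ?thesis using det [OF z] by simp
      qed
      have "inverse e = e" using e0 by (metis inverse_unique)
      have yi: "y (i, b) = y (0, b) * e ^ i" if "i < m" for i b
      proof -
        have "complex_of_real (y (i, b)) = complex_of_real (y (0, b)) * inverse (of_real e) ^ i"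
          using m0 eC F0 that unfolding F_def by (rule single_fourier_coefficient)
        also have "\<dots> = complex_of_real (y (0, b) * inverse e ^ i)" by simp
        finally show ?thesis unfolding \<open>inverse e = e\<close> by (simp only: of_real_eq_iff)
      qed
      \<comment> \<open>On both cosets of the rotations \<open>y\<close> is now a multiple of the
        powers of \<open>e\<close>. The equation at the identity links the two multiples: the block
        at \<open>e\<close> has rank one because its entry from \<open>T\<close> is nonzero.\<close>
      have "(\<Sum>r\<in>R. y (r mod m, False)) + (\<Sum>t\<in>T. y (t mod m, True)) = 0"
        using y [OF m0, of False] by simp
      also have "(\<Sum>r\<in>R. y (r mod m, False)) = y (0, False) * (\<Sum>r\<in>R. e ^ r)"
        unfolding sum_distrib_left
      proof (intro sum.cong refl)
        fix r assume "r \<in> R"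
        then have "r < m" using R' by auto
        then show "y (r mod m, False) = y (0, False) * e ^ r"
          using yi [of r False] by simp
      qed
      also have "(\<Sum>t\<in>T. y (t mod m, True)) = y (0, True) * (\<Sum>t\<in>T. e ^ t)"
        unfolding sum_distrib_left
      proof (intro sum.cong refl)
        fix t assume "t \<in> T"
        then have "t < m" using T by auto
        then show "y (t mod m, True) = y (0, True) * e ^ t"
          using yi [of t True] by simp
      qed
      also have "(\<Sum>r\<in>R. e ^ r) = - (s * (\<Sum>t\<in>T. e ^ t))"
        using sing' by linarith
      finally have "(y (0, True) - y (0, False) * s) * (\<Sum>t\<in>T. e ^ t) = 0"
        by (simp add: algebra_simps)
      then have "y (0, True) = y (0, False) * s" using T0' by simp
      then have "y (i, b) = y (0, False) * x (i, b)" if "i < m" for i b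
        using yi [OF that, of b] by (cases b) (simp_all add: x_def)
      then show "\<exists>c. \<forall>v\<in>?V. y v = c * x v"
        by (intro exI [of _ "y (0, False)"]) (clarify, simp only: atLeastLessThan_iff)
    qed
  qed (use m0 in auto)
  moreover have "regular_graph (?V) (cayley_adj ?G ?C) (card R + card T)"
    unfolding regular_graph_def
  proof
    fix u assume "u \<in> ?V"
    then obtain i b where "u = (i, b)" "i < m" by auto
    then show "card (neighbours (?V) (cayley_adj ?G ?C) u) = card R + card T"
      using sum_neighbours_dihedral [OF R' T, of i "\<lambda>_. 1 :: nat" b] by simp
  qed
  moreover have "connection_set ?G ?C"
    unfolding connection_set_def carrier_dihedral_group
  proof (intro conjI ballI)
    show "?C \<subseteq> ?V - {\<one>\<^bsub>?G\<^esub>}" using R T by (auto simp: dihedral_group_def)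
    fix c assume "c \<in> ?C"
    then show "inv\<^bsub>?G\<^esub> c \<in> ?C"
      using R T by (cases c) (auto simp: inv_dihedral_group subset_iff)
  qed
  ultimately show ?thesis
    unfolding dihedral_nut_def carrier_dihedral_group
    by (intro exI [of _ ?C]) (simp add: card_cartesian_product)
qed

section \<open>Connection sets\<close>

lemma power_sum_empty [simp]: "power_sum {} z = 0"
  by (simp add: power_sum_def)

lemma power_sum_insert [simp]: "finite S \<Longrightarrow> a \<notin> S \<Longrightarrow> power_sum (insert a S) z = z ^ a + power_sum S z"
  by (simp add: power_sum_def)

lemma power_sum_Un:
  "finite S \<Longrightarrow> finite T \<Longrightarrow> S \<inter> T = {} \<Longrightarrow> power_sum (S \<union> T) z = power_sum S z + power_sum T z"
  by (simp add: power_sum_def sum.union_disjoint)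

lemma power_sum_Diff:
  "finite S \<Longrightarrow> T \<subseteq> S \<Longrightarrow> power_sum (S - T) z = power_sum S z - power_sum T z"
  by (simp add: power_sum_def sum_diff)

lemma power_sum_one [simp]: "power_sum S 1 = of_nat (card S)"
  by (simp add: power_sum_def)

lemma power_sum_all:
  assumes "z ^ m = 1" "z \<noteq> 1"
  shows "power_sum {0..<m} z = 0"
  using assms by (simp add: power_sum_def atLeast0LessThan geometric_sum)

text \<open>A sum of an odd number of signs is an odd integer.\<close>

lemma power_sum_minus_one_nonzero:
  assumes "finite S" "odd (card S)"
  shows "power_sum S (-1) \<noteq> 0"
proof -
  have "odd (\<Sum>s\<in>S. (-1 :: int) ^ s)"
    using assms by (subst even_sum_iff) (simp_all add: even_sum_iff)
  then have "of_int (\<Sum>s\<in>S. (-1 :: int) ^ s) \<noteq> (0 :: complex)"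
    by (metis even_zero of_int_eq_0_iff)
  then show ?thesis by (simp add: power_sum_def)
qed

text \<open>The preimage of \<open>A\<close> under reduction from the integers modulo
  \<open>2 * M\<close> to those modulo \<open>M\<close>. Its power sum has the factor
  \<open>1 + z ^ M\<close>, which is 0 or 2 when \<open>z ^ (2 * M) = 1\<close>.\<close>

definition double :: "nat \<Rightarrow> nat set \<Rightarrow> nat set" where
  "double M A = A \<union> (\<lambda>a. a + M) ` A"

lemma
  assumes "A \<subseteq> {0..<M}"
  shows power_sum_double: "power_sum (double M A) z = (1 + z ^ M) * power_sum A z"
    and card_double: "card (double M A) = 2 * card A"
    and finite_double: "finite (double M A)"
proof -
  have fin: "finite A" using assms finite_atLeastLessThan by (rule finite_subset)
  then show "finite (double M A)" by (simp add: double_def)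
  have disj: "A \<inter> (\<lambda>a. a + M) ` A = {}" using assms by auto
  have inj: "inj_on (\<lambda>a. a + M) A" by (simp add: inj_on_def)
  have "power_sum ((\<lambda>a. a + M) ` A) z = z ^ M * power_sum A z"
    by (simp add: power_sum_def sum.reindex [OF inj] power_add sum_distrib_left mult.commute)
  then show "power_sum (double M A) z = (1 + z ^ M) * power_sum A z"
    using fin disj by (simp add: double_def power_sum_Un distrib_right)
  show "card (double M A) = 2 * card A"
    using fin disj by (simp add: double_def card_Un_disjoint card_image [OF inj])
qed

lemma double_iff:
  assumes "A \<subseteq> {0..<M}"
  shows "x \<in> double M A \<longleftrightarrow> x < 2 * M \<and> x mod M \<in> A"
proof
  assume "x \<in> double M A"
  then consider "x \<in> A" | a where "a \<in> A" "x = a + M" by (auto simp: double_def)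
  then show "x < 2 * M \<and> x mod M \<in> A"
  proof cases
    case 1
    then have "x < M" using assms by auto
    then show ?thesis using 1 by simp
  next
    case 2
    then have "a < M" using assms by auto
    then show ?thesis using 2 by simp
  qed
next
  assume x: "x < 2 * M \<and> x mod M \<in> A"
  show "x \<in> double M A"
  proof (cases "x < M")
    case True
    then show ?thesis using x by (simp add: double_def)
  next
    case False
    moreover have "x - M < M" using x False by auto
    ultimately have "x mod M = x - M" by (simp add: le_mod_geq)
    then show ?thesis using x False by (auto simp: double_def image_iff intro!: bexI [of _ "x - M"])
  qed
qed

definition symmetric_set :: "nat \<Rightarrow> nat set \<Rightarrow> bool" where
  "symmetric_set m S \<longleftrightarrow> S \<subseteq> {0<..<m} \<and> (\<forall>s\<in>S. m - s \<in> S)"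

lemma symmetric_set_double:
  assumes "symmetric_set M A"
  shows "symmetric_set (2 * M) (double M A)"
  unfolding symmetric_set_def
proof (intro conjI ballI)
  show "double M A \<subseteq> {0<..<2 * M}"
    using assms by (force simp: double_def symmetric_set_def)
  fix s assume "s \<in> double M A"
  then consider "s \<in> A" | a where "a \<in> A" "s = a + M" by (auto simp: double_def)
  then show "2 * M - s \<in> double M A"
  proof cases
    case 1
    then have "M - s \<in> A" "s < M" using assms by (auto simp: symmetric_set_def)
    moreover from this have "2 * M - s = (M - s) + M" by simp
    ultimately show ?thesis unfolding double_def by blast
  next
    case 2
    then have "M - a \<in> A" "2 * M - s = M - a" using assms by (auto simp: symmetric_set_def)
    then show ?thesis by (simp add: double_def)
  qed
qed

text \<open>Pairs of \<open>a\<close> and \<open>m - a\<close> are added one at a time. As long as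
  two elements of \<open>P\<close> are free, one of them is not \<open>m div 2\<close>, the only
  possible fixed point of negation. The parity of the cardinality is therefore that of
  \<open>K\<close>.\<close>

lemma symmetric_superset:
  assumes P: "symmetric_set m P" and K: "symmetric_set m K" "K \<subseteq> P"
    and "card K + 2 * j \<le> card P"
  shows "\<exists>A. symmetric_set m A \<and> K \<subseteq> A \<and> A \<subseteq> P \<and> card A = card K + 2 * j"
  using \<open>card K + 2 * j \<le> card P\<close>
proof (induction j)
  case 0
  then show ?case using K by auto
next
  case (Suc j)
  then obtain A where A: "symmetric_set m A" "K \<subseteq> A" "A \<subseteq> P" "card A = card K + 2 * j"
    by auto
  have finP: "finite P" using P finite_subset by (auto simp: symmetric_set_def)
  then have finA: "finite A" using A(3) finite_subset by blast
  have "card (P - A) = card P - card A" using A(3) finA by (simp add: card_Diff_subset)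
  then have "card (P - A) \<ge> 2" using Suc.prems A(4) by simp
  then have "\<not> P - A \<subseteq> {m div 2}"
    using card_mono [of "{m div 2}" "P - A"] by auto
  then obtain a where a: "a \<in> P" "a \<notin> A" "a \<noteq> m div 2" by blast
  have am: "a < m" "m - a \<in> P" using P a by (auto simp: symmetric_set_def)
  have "m - a \<notin> A"
  proof
    assume "m - a \<in> A"
    then have "m - (m - a) \<in> A" using A(1) by (simp add: symmetric_set_def)
    then show False using a am by simp
  qed
  moreover have "a \<noteq> m - a" using a(3) am by auto
  ultimately have "card (insert a (insert (m - a) A)) = card K + 2 * Suc j"
    using A(4) finA a by simp
  moreover have "symmetric_set m (insert a (insert (m - a) A))"
    using A(1) P a am by (auto simp: symmetric_set_def)
  ultimately show ?case using A a am
    by (intro exI [of _ "insert a (insert (m - a) A)"]) auto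
qed

lemma symmetric_set_interval: "symmetric_set m {0<..<m}"
  by (auto simp: symmetric_set_def)

text \<open>For odd order, \<^term>\<open>1 + y\<^sup>2 = (1 - y^4) / (1 - y\<^sup>2)\<close> is a unit.\<close>

lemma unit_root_plus_inverse:
  fixes z :: complex
  assumes z: "z ^ m = 1" "odd m" and y: "y = z ^ j" "y \<noteq> 1"
  obtains v where "v \<in> int_adjoin z" "v * (y + inverse y) = 1"
proof -
  have m0: "m > 0" using \<open>odd m\<close> by (rule odd_pos)
  then have y0: "y \<noteq> 0" using z y by (auto simp: power_0_left)
  have ym: "y ^ m = 1" unfolding y by (metis power_commutes power_mult power_one z(1) mult.commute)
  have y2: "y\<^sup>2 \<noteq> 1"
  proof
    assume "y\<^sup>2 = 1"
    moreover obtain l where "m = 2 * l + 1" using \<open>odd m\<close> oddE by blast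
    ultimately have "y ^ m = y" by (simp add: power_mult)
    then show False using ym y by simp
  qed
  \<comment> \<open>With this \<open>l\<close>,
    \<open>(y ^ 4) ^ l = y ^ (2 * m + 2) = y ^ 2\<close>, so the geometric sum \<open>S\<close>
    below is the inverse of \<open>1 + y ^ 2\<close>.\<close>
  obtain l where l: "m + 1 = 2 * l" using \<open>odd m\<close> by (metis even_Suc Suc_eq_plus1 evenE)
  define S where "S = (\<Sum>i<l. (y ^ 4) ^ i)"
  have "(y\<^sup>2 - 1) * ((1 + y\<^sup>2) * S) = (y ^ 4 - 1) * S"
    by (simp add: algebra_simps power2_eq_square power4_eq_xxxx)
  also have "\<dots> = (y ^ 4) ^ l - 1"
    unfolding S_def by (rule power_diff_1_eq [symmetric])
  also have "(y ^ 4) ^ l = (y ^ (2 * l))\<^sup>2"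
    by (simp flip: power_mult add: mult_ac)
  also have "\<dots> = y\<^sup>2" using ym by (simp flip: l)
  finally have "(1 + y\<^sup>2) * S = 1" using y2 by simp
  then have "(y * S) * (y + inverse y) = 1"
    using y0 by (simp add: algebra_simps power2_eq_square)
  moreover have "y * S \<in> int_adjoin z"
    unfolding S_def y by (intro int_adjoin_mult int_adjoin_sum int_adjoin_power int_adjoin_self)
  ultimately show thesis using that by blast
qed

text \<open>For \<open>e * e = 1\<close> the equation reads \<open>(z - e) ^ 2 = 0\<close> after
  multiplication by \<open>z\<close>.\<close>

lemma sum_inverse_eq_two:
  fixes z :: complex
  assumes "z \<noteq> 0" "e * e = 1" "z + inverse z = 2 * e"
  shows "z = e"
proof -
  have "(z - e) * (z - e) = z * (z + inverse z - 2 * e) + (e * e - z * inverse z)"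
    by (simp add: algebra_simps)
  also have "\<dots> = 0" using assms by simp
  finally show ?thesis by simp
qed

text \<open>From \<open>z * i = 1\<close> comes
  \<open>(1 + z) * (1 + i) = (1 + z) + (1 + i)\<close>, so the terms linear and quadratic in
  \<open>p\<close> share this factor. The left side is the negated dihedral determinant when
  rotations contribute \<open>2 * a\<close> and reflections
  \<open>2 * a + (1 + z) * p\<close>.\<close>

lemma det_identity:
  fixes z i a p :: complex
  assumes "z * i = 1"
  shows "(2 * a + (1 + z) * p) * (2 * a + (1 + i) * p) - (2 * a) * (2 * a) = (1 + z) * (1 + i) * (p * (2 * a + p))"
proof -
  have "(1 + z) * (1 + i) = 2 + z + i" using assms by (simp add: algebra_simps)
  then have "(1 + z) * (1 + i) * (p * (2 * a + p)) = (2 + z + i) * (2 * a * p) + ((1 + z) * p) * ((1 + i) * p)"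
    by (simp add: algebra_simps)
  then show ?thesis by (simp add: algebra_simps)
qed

section \<open>Circulant graphs on twice an odd number of vertices\<close>

text \<open>The unpaired elements are 1, -1 and the lifts \<open>m - 3\<close>, \<open>m + 3\<close>
  of -3 and 3. Put \<open>u = z + inverse z\<close>. At \<open>z ^ m = 1\<close> they sum to
  \<open>u\<close> times its analogue for \<open>z ^ 2\<close>, a product of units unless
  \<open>z = 1\<close>. At \<open>z ^ m = -1\<close> the lifts change sign and the sum is
  \<open>u * (2 - u) * (2 + u)\<close>: here \<open>u = 0\<close> would give
  \<open>z ^ 2 = -1\<close>, impossible for odd \<open>m\<close>, and \<open>u = 2\<close> would
  give \<open>z = 1\<close>, so only \<open>z = -1\<close> remains.\<close>

lemma cyclic_nut_odd:
  assumes "odd m" "even k" "k \<ge> 2" "k + 2 \<le> m"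
  shows "cyclic_nut (2 * m) (2 * k)"
proof -
  have m5: "m \<ge> 5" and k3: "k + 3 \<le> m"
    using assms by presburger+
  \<comment> \<open>The residues modulo \<open>m\<close> of the unpaired elements, which
    \<open>A\<close> has to avoid. They leave \<open>m - 5\<close> residues, enough for
    \<open>k - 2\<close> since parity improves the bound to \<open>k + 3 \<le> m\<close>.\<close>
  define Q where "Q = {1, m - 1, 3, m - 3}"
  have cQ: "card Q = 4" using m5 \<open>odd m\<close> by (auto simp: Q_def card_insert_if) presburger+
  have symP: "symmetric_set m ({0<..<m} - Q)"
    using m5 by (auto simp: symmetric_set_def Q_def)
  have "Q \<subseteq> {0<..<m}" "finite Q" using m5 by (auto simp: Q_def)
  then have cP: "card ({0<..<m} - Q) = m - 5"
    by (simp add: card_Diff_subset cQ)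
  have "\<exists>A. symmetric_set m A \<and> {} \<subseteq> A \<and> A \<subseteq> {0<..<m} - Q \<and> card A = card ({} :: nat set) + 2 * ((k - 2) div 2)"
    using symP by (rule symmetric_superset) (use k3 cP assms in \<open>auto simp: symmetric_set_def\<close>)
  then obtain A where A: "symmetric_set m A" "A \<subseteq> {0<..<m} - Q" "card A = k - 2"
    using assms by auto
  have A': "A \<subseteq> {0..<m}" using A(2) by auto
  define S where "S = {1, 2 * m - 1, m - 3, m + 3}"
  have S: "symmetric_set (2 * m) S"
    using m5 by (auto simp: symmetric_set_def S_def)
  have cS: "card S = 4" using m5 by (auto simp: S_def card_insert_if)
  have disj: "S \<inter> double m A = {}"
  proof -
    have "(2 * m - 1) mod m = m - 1" "(m + 3) mod m = 3" "(m - 3) mod m = m - 3" "1 mod m = 1"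
      using m5 by (auto simp: mod_if)
    then show ?thesis
      using A(2) by (auto simp: double_iff [OF A'] S_def Q_def)
  qed
  have finS: "finite S" by (simp add: S_def)
  have sym: "symmetric_set (2 * m) (S \<union> double m A)"
    using S symmetric_set_double [OF A(1)] by (auto simp: symmetric_set_def)
  have ps: "power_sum (S \<union> double m A) z
    = z + z ^ (2 * m - 1) + z ^ (m - 3) + z ^ (m + 3) + (1 + z ^ m) * power_sum A z" for z
  proof -
    have "power_sum S z = z + z ^ (2 * m - 1) + z ^ (m - 3) + z ^ (m + 3)"
    proof -
      have "1 \<noteq> 2 * m - 1" "1 \<noteq> m - 3" "1 \<noteq> m + 3" "2 * m - 1 \<noteq> m - 3" "2 * m - 1 \<noteq> m + 3" "m - 3 \<noteq> m + 3"
        using m5 by arith+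
      then show ?thesis by (simp add: S_def add.assoc)
    qed
    then show ?thesis
      by (simp add: power_sum_Un finS finite_double [OF A'] disj power_sum_double [OF A'])
  qed
  have "cyclic_nut (2 * m) (card (S \<union> double m A))"
  proof (rule cyclic_nutI)
    show "power_sum (S \<union> double m A) (- 1) = 0"
      using m5 \<open>odd m\<close> by (simp add: ps)
    fix z :: complex assume z: "z ^ (2 * m) = 1" "z \<noteq> - 1"
    define i where "i = inverse z"
    have z0: "z \<noteq> 0" using z m5 by (auto simp: power_0_left)
    have zi: "z * i = 1" using z0 by (simp add: i_def)
    have e: "z ^ (2 * m - 1) = i"
      unfolding i_def using inverse_root_unity [OF z(1)] m5 by simp
    have "z ^ m * i ^ 3 = z ^ (m - 3) * (z ^ 3 * i ^ 3)"
      using m5 by (simp flip: power_add mult.assoc)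
    also have "z ^ 3 * i ^ 3 = 1" using zi by (simp flip: power_mult_distrib)
    finally have e3: "z ^ (m - 3) = z ^ m * i ^ 3" by simp
    have "(z ^ m)\<^sup>2 = 1" using z(1) by (simp flip: power_mult add: mult.commute)
    then consider "z ^ m = 1" | "z ^ m = - 1" by (auto simp: power2_eq_1_iff)
    then show "power_sum (S \<union> double m A) z \<noteq> 0"
    proof cases
      case 1
      have sum: "power_sum (S \<union> double m A) z = (z\<^sup>2 + i\<^sup>2) * (z + i) + 2 * power_sum A z"
      proof -
        have "(z\<^sup>2 + i\<^sup>2) * (z + i) = z ^ 3 + i ^ 3 + (z * i) * (z + i)"
          by (simp add: algebra_simps power2_eq_square power3_eq_cube)
        then show ?thesis unfolding ps e e3 using 1 zi by (simp add: power_add)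
      qed
      show ?thesis
      proof (cases "z = 1")
        case True
        then have "power_sum (S \<union> double m A) z = of_nat (4 + 2 * card A)"
          unfolding sum by (simp add: i_def)
        then show ?thesis by (metis of_nat_eq_0_iff add_is_0 zero_neq_numeral)
      next
        case False
        have "z\<^sup>2 \<noteq> 1"
        proof
          assume "z\<^sup>2 = 1"
          then have "z = - 1" using False by (simp add: power2_eq_1_iff)
          then show False using z(2) by simp
        qed
        then obtain v where v: "v \<in> int_adjoin z" "v * (z\<^sup>2 + inverse (z\<^sup>2)) = 1"
          using unit_root_plus_inverse [OF 1 \<open>odd m\<close>, of "z\<^sup>2" 2] by blast
        obtain w where w: "w \<in> int_adjoin z" "w * (z + inverse z) = 1"
          using unit_root_plus_inverse [OF 1 \<open>odd m\<close>, of z 1] False by auto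
        show ?thesis
        proof
          assume "power_sum (S \<union> double m A) z = 0"
          then have eq: "2 * power_sum A z = - ((z\<^sup>2 + i\<^sup>2) * (z + i))"
            unfolding sum by (simp only: add.commute eq_neg_iff_add_eq_0)
          have "2 * (v * w * power_sum A z) = v * w * (2 * power_sum A z)"
            by simp
          also have "\<dots> = - ((v * (z\<^sup>2 + i\<^sup>2)) * (w * (z + i)))"
            unfolding eq by (simp only: mult_minus_right mult_ac)
          also have "\<dots> = of_int (- 1)"
            using v(2) w(2) by (simp add: i_def power_inverse)
          finally have "2 * (v * w * power_sum A z) = of_int (- 1)" .
          moreover have "v * w * power_sum A z \<in> int_adjoin z"
            using v(1) w(1) by (intro int_adjoin_mult int_adjoin_power_sum int_adjoin_self)
          ultimately show False
            using even_not_odd_int_adjoin [OF 1 _ _ , of "v * w * power_sum A z" "- 1"] m5 by simp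
        qed
      qed
    next
      case 2
      define u where "u = z + i"
      have u3: "u ^ 3 = z ^ 3 + i ^ 3 + 3 * u"
      proof -
        have "u ^ 3 = z ^ 3 + i ^ 3 + 3 * ((z * i) * u)"
          by (simp add: u_def algebra_simps power3_eq_cube)
        then show ?thesis using zi by simp
      qed
      have "power_sum (S \<union> double m A) z = z + i - (z ^ 3 + i ^ 3)"
        unfolding ps e e3 using 2 by (simp add: power_add)
      also have "\<dots> = u - (u ^ 3 - 3 * u)"
        unfolding u3 by (simp add: u_def)
      also have "\<dots> = u * (2 - u) * (2 + u)"
        by (simp add: algebra_simps power3_eq_cube)
      finally have sum: "power_sum (S \<union> double m A) z = u * (2 - u) * (2 + u)" .
      have "u \<noteq> 0"
      proof
        assume "u = 0"
        then have "z * (z + i) = 0" by (simp add: u_def)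
        then have "z\<^sup>2 = - 1" using zi by (simp add: power2_eq_square distrib_left eq_neg_iff_add_eq_0)
        then have "z ^ (2 * m) = - 1" using \<open>odd m\<close> by (simp add: power_mult)
        then show False using z(1) by simp
      qed
      moreover have "u \<noteq> 2"
        using sum_inverse_eq_two [OF z0, of 1] 2 by (auto simp: u_def i_def)
      moreover have "u \<noteq> - 2"
        using sum_inverse_eq_two [OF z0, of "- 1"] z(2) by (auto simp: u_def i_def)
      ultimately have "u \<noteq> 0" "2 - u \<noteq> 0" "2 + u \<noteq> 0" by (simp_all add: add_eq_0_iff)
      then show ?thesis unfolding sum by simp
    qed
  qed (use m5 sym in \<open>auto simp: symmetric_set_def\<close>)
  moreover have "card (S \<union> double m A) = 2 * k"
    using finS disj A(3) cS assms
    by (simp add: card_Un_disjoint finite_double [OF A'] card_double [OF A'])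
  ultimately show ?thesis by simp
qed

section \<open>Dihedral groups: reflections and rotations in cosets of the centre\<close>

lemma root_unity_double:
  fixes z :: complex
  assumes "z ^ (2 * M) = 1"
  obtains "z ^ M = 1" | "z ^ M = - 1"
proof -
  have "(z ^ M)\<^sup>2 = 1" using assms by (simp flip: power_mult add: mult.commute)
  then show thesis using that by (auto simp: power2_eq_1_iff)
qed

section \<open>Dihedral groups of order 4M with M even\<close>

text \<open>With the sign \<open>w = z ^ (2 * q)\<close>, singularity means
  \<open>2 + 2 * w = 2 + z + inverse z\<close>. Then \<open>z = w\<close> is itself a sign, so
  \<open>w = (z * z) ^ q = 1\<close>.\<close>

lemma dihedral_nut_four:
  assumes "q \<ge> 1"
  shows "dihedral_nut (4 * q) 4"
proof -
  have R: "power_sum {q, 3 * q} z = z ^ q + z ^ (3 * q)" for z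
    using assms by simp
  have T: "power_sum {0, 1} z = 1 + z" for z
    by simp
  have "dihedral_nut (4 * q) (card {q, 3 * q} + card {0, 1 :: nat})"
  proof (rule dihedral_nutI [where e = 1 and s = "- 1"])
    fix z :: complex assume z: "z ^ (4 * q) = 1" "z \<noteq> of_real 1"
    have z0: "z \<noteq> 0" using z assms by (auto simp: power_0_left)
    define w where "w = z ^ (2 * q)"
    have ww: "w * w = 1" using z(1) by (simp add: w_def flip: power_add)
    show "power_sum {q, 3 * q} z * power_sum {q, 3 * q} z \<noteq> power_sum {0, 1} z * power_sum {0, 1} (inverse z)"
    proof
      assume eq: "power_sum {q, 3 * q} z * power_sum {q, 3 * q} z = power_sum {0, 1} z * power_sum {0, 1} (inverse z)"
      have "z ^ (3 * q) = z ^ q * w" by (simp add: w_def flip: power_add)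
      moreover have "z ^ q * z ^ q = w" by (simp add: w_def mult_2 flip: power_add)
      ultimately have "(z ^ q + z ^ (3 * q)) * (z ^ q + z ^ (3 * q)) = w * ((1 + w) * (1 + w))"
        by (simp add: algebra_simps)
      also have "\<dots> = w + 2 * (w * w) + w * w * w" by (simp add: algebra_simps)
      also have "\<dots> = 2 + 2 * w" using ww by simp
      finally have "2 + 2 * w = (1 + z) * (1 + inverse z)" using eq unfolding R T by simp
      then have "z + inverse z = 2 * w" using z0 by (simp add: algebra_simps)
      then have zw: "z = w" using sum_inverse_eq_two [OF z0 ww] by simp
      have "w = (z * z) ^ q" by (simp add: w_def power_mult power2_eq_square)
      also have "z * z = 1" unfolding zw by (rule ww)
      finally show False using zw z(2) by simp
    qed
  qed (use assms in \<open>auto simp: R\<close>)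
  moreover have "card {q, 3 * q} + card {0, 1 :: nat} = 4"
    using assms by simp
  ultimately show ?thesis by (simp only:)
qed

text \<open>\<open>T\<close> is \<open>double M A\<close> with \<open>M + 1\<close> exchanged for
  \<open>0\<close>; equal sizes of rotation and reflection part give the zero at 1. At
  \<open>z ^ M = 1\<close> the two power sums are \<open>2 * a\<close> and
  \<open>2 * a + 1 - z\<close>, so \<open>det_identity\<close> applies at \<open>- z\<close>. At
  \<open>z ^ M = -1\<close> the rotations vanish and \<open>1 + z\<close> remains, nonzero because
  \<open>M\<close> is even.\<close>

lemma dihedral_nut_double_even:
  assumes "even M" "g \<ge> 2" "g < M"
  shows "dihedral_nut (2 * M) (4 * g)"
proof -
  have M4: "M \<ge> 4" using assms by presburger
  \<comment> \<open>\<open>A\<close> must contain 1, hence \<open>M - 1\<close>; the self-inverse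
    residue \<open>M div 2\<close> adjusts the parity of \<open>g\<close>, as all further elements
    come in pairs.\<close>
  define K where "K = (if even g then {1, M - 1} else {1, M - 1, M div 2})"
  have cK: "card K = (if even g then 2 else 3)"
    using M4 \<open>even M\<close> by (auto simp: K_def card_insert_if)
  have symK: "symmetric_set M K"
    using M4 \<open>even M\<close> by (auto simp: K_def symmetric_set_def)
  have cg: "card K + 2 * ((g - card K) div 2) = g"
    using assms cK by presburger
  have "\<exists>A. symmetric_set M A \<and> K \<subseteq> A \<and> A \<subseteq> {0<..<M} \<and> card A = card K + 2 * ((g - card K) div 2)"
    using symmetric_set_interval symK
    by (rule symmetric_superset) (use assms symK in \<open>auto simp: symmetric_set_def cg\<close>)
  then obtain A where A: "symmetric_set M A" "K \<subseteq> A" "card A = g"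
    unfolding cg by blast
  have "1 \<in> A" using A(2) by (auto simp: K_def split: if_splits)
  note A = A(1) this A(3)
  have A': "A \<subseteq> {0..<M}" "0 \<notin> A" using A(1) by (auto simp: symmetric_set_def)
  have finA: "finite A" using A'(1) finite_subset by blast
  define T where "T = {0, 1} \<union> double M (A - {1})"
  have A1: "A - {1} \<subseteq> {0..<M}" using A' by auto
  have disj: "{0, 1} \<inter> double M (A - {1}) = {}"
    using A' M4 by (auto simp: double_def)
  have R: "power_sum (double M A) z = (1 + z ^ M) * power_sum A z" for z
    by (rule power_sum_double [OF A'(1)])
  have T: "power_sum T z = 1 + z + (1 + z ^ M) * (power_sum A z - z)" for z
  proof -
    have "power_sum T z = power_sum {0, 1} z + power_sum (double M (A - {1})) z"
      unfolding T_def by (intro power_sum_Un finite_double [OF A1] disj) simp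
    then show ?thesis
      unfolding power_sum_double [OF A1] using finA A(2) by (simp add: power_sum_Diff)
  qed
  have "dihedral_nut (2 * M) (card (double M A) + card T)"
  proof (rule dihedral_nutI [where e = 1 and s = "- 1"])
    fix z :: complex assume z: "z ^ (2 * M) = 1" "z \<noteq> of_real 1"
    define i where "i = inverse z"
    have z0: "z \<noteq> 0" using z M4 by (auto simp: power_0_left)
    have zi: "z * i = 1" using z0 by (simp add: i_def)
    from z(1) show "power_sum (double M A) z * power_sum (double M A) z \<noteq> power_sum T z * power_sum T (inverse z)"
    proof (cases rule: root_unity_double)
      case 1
      have i1: "i ^ M = 1" using 1 by (simp add: i_def power_inverse)
      define a where "a = power_sum A z"
      have ai: "power_sum A i = a"
        unfolding a_def i_def using A(1) 1 M4 by (intro power_sum_inverse) (auto simp: symmetric_set_def)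
      have "power_sum T z * power_sum T i - power_sum (double M A) z * power_sum (double M A) z
        = (1 - z) * (1 - i) * (1 * (2 * a + 1))"
        using det_identity [of "- z" "- i" a 1] zi
        unfolding R T ai a_def [symmetric] 1 i1 by (simp add: algebra_simps)
      moreover have "2 * a \<noteq> of_int (- 1)"
        unfolding a_def using 1 M4 by (intro even_not_odd_int_adjoin [of z M]) auto
      then have "2 * a + 1 \<noteq> 0" by (simp add: eq_neg_iff_add_eq_0)
      moreover have "1 - z \<noteq> 0" "1 - i \<noteq> 0" using z(2) zi by auto
      ultimately show ?thesis by (auto simp: i_def)
    next
      case 2
      have i1: "i ^ M = - 1" using 2 by (simp add: i_def power_inverse)
      have "z \<noteq> - 1" using 2 \<open>even M\<close> by auto
      then have "1 + z \<noteq> 0" by (simp add: add_eq_0_iff)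
      moreover have "z * (1 + i) = 1 + z" using zi by (simp add: algebra_simps)
      ultimately have "(1 + z) * (1 + i) \<noteq> 0" by auto
      then show ?thesis
        unfolding R T i_def [symmetric] 2 i1 by simp
    qed
  next
    show "power_sum (double M A) (of_real 1) + of_real (- 1) * power_sum T (of_real 1) = 0"
      unfolding R T by simp
    show "power_sum T (of_real 1) \<noteq> 0" unfolding T using A(3) assms by simp
    show "T \<subseteq> {0..<2 * M}"
      using A' M4 by (auto simp: T_def double_def)
  qed (use M4 symmetric_set_double [OF A(1)] in \<open>auto simp: symmetric_set_def\<close>)
  moreover have "card T = 2 * g"
  proof -
    have "card T = card {0, 1 :: nat} + card (double M (A - {1}))"
      unfolding T_def by (intro card_Un_disjoint finite_double [OF A1] disj) simp
    then show ?thesis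
      unfolding card_double [OF A1] using finA A(2,3) assms by (simp add: card_Diff_singleton)
  qed
  ultimately show ?thesis by (simp add: card_double [OF A'(1)] A(3))
qed

text \<open>At \<open>z\<close> with \<open>z ^ M = 1\<close> and \<open>a = power_sum A z\<close>, the determinant is
  \<open>- (1 + z) (1 + 1/z) p (2 a + p)\<close>, where \<open>p = 1\<close> or \<open>p = 1 - 2 z ^ (M div 2)\<close> is an odd
  integer.\<close>

lemma dihedral_nut_double_sign:
  assumes "even M" "M \<ge> 4" and A: "symmetric_set M A" "odd (card A)" "1 \<notin> A"
    and D: "D = {} \<or> D = {M div 2, M div 2 + 1}" "D \<subseteq> A"
  shows "dihedral_nut (2 * M) (4 * card A + 2 - 2 * card D)"
proof -
  have A': "A \<subseteq> {0..<M}" "0 \<notin> A" using A(1) by (auto simp: symmetric_set_def)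
  have finA: "finite A" using A'(1) finite_subset by blast
  have finD: "finite D" using finA D(2) by (rule finite_subset [rotated])
  define T where "T = {0, 1} \<union> double M (A - D)"
  have A1: "A - D \<subseteq> {0..<M}" using A' by auto
  have disj: "{0, 1} \<inter> double M (A - D) = {}"
    using A' A(3) assms(2) by (auto simp: double_def)
  have R: "power_sum (double M A) z = (1 + z ^ M) * power_sum A z" for z
    by (rule power_sum_double [OF A'(1)])
  have T: "power_sum T z = 1 + z + (1 + z ^ M) * (power_sum A z - power_sum D z)" for z
    using disj finA D(2)
    by (simp add: T_def power_sum_Un finite_double [OF A1] power_sum_double [OF A1] power_sum_Diff)
  \<comment> \<open>Two consecutive exponents give \<open>D\<close> the same factor
    \<open>1 + z\<close> as the unpaired reflections \<open>0\<close> and \<open>1\<close>. One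
    integer \<open>p\<close> serves \<open>z\<close> and its inverse because
    \<open>z ^ (M div 2)\<close> is a sign.\<close>
  have PD: "\<exists>p. (p = 1 \<or> p = - 1 \<or> p = 3) \<and> 2 * power_sum D z = (1 + z) * (1 - of_int p)
      \<and> 2 * power_sum D (inverse z) = (1 + inverse z) * (1 - of_int p)"
    if "z ^ M = 1" for z
    using D(1)
  proof
    assume "D = {}"
    then show ?thesis by (intro exI [of _ 1]) simp
  next
    assume D: "D = {M div 2, M div 2 + 1}"
    have pD: "power_sum D z = z ^ (M div 2) * (1 + z)" for z
      by (simp add: D algebra_simps)
    have "z ^ (2 * (M div 2)) = 1" using that \<open>even M\<close> by simp
    then show ?thesis
    proof (cases rule: root_unity_double)
      case 1
      then show ?thesis
        by (intro exI [of _ "- 1"]) (simp add: pD power_inverse)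
    next
      case 2
      then show ?thesis
        by (intro exI [of _ 3]) (simp add: pD power_inverse algebra_simps)
    qed
  qed
  have PD1: "power_sum D (- 1) = 0"
    using PD [of "- 1"] \<open>even M\<close> by auto
  have "dihedral_nut (2 * M) (card (double M A) + card T)"
  proof (rule dihedral_nutI [where e = "- 1" and s = "- 1"])
    fix z :: complex assume z: "z ^ (2 * M) = 1" "z \<noteq> of_real (- 1)"
    define i where "i = inverse z"
    have z0: "z \<noteq> 0" using z assms(2) by (auto simp: power_0_left)
    have zi: "z * i = 1" using z0 by (simp add: i_def)
    have "1 + z \<noteq> 0" using z(2) by (simp add: add_eq_0_iff)
    moreover have "1 + i \<noteq> 0"
    proof
      assume "1 + i = 0"
      then have "z * (1 + i) = 0" by simp
      then show False using zi \<open>1 + z \<noteq> 0\<close> by (simp add: algebra_simps)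
    qed
    ultimately have nz: "(1 + z) * (1 + i) \<noteq> 0" by simp
    from z(1) show "power_sum (double M A) z * power_sum (double M A) z \<noteq> power_sum T z * power_sum T (inverse z)"
    proof (cases rule: root_unity_double)
      case 1
      have i1: "i ^ M = 1" using 1 by (simp add: i_def power_inverse)
      define a where "a = power_sum A z"
      have ai: "power_sum A i = a"
        unfolding a_def i_def using A(1) 1 assms(2)
        by (intro power_sum_inverse) (auto simp: symmetric_set_def)
      obtain p where p: "p = 1 \<or> p = - 1 \<or> p = 3" "2 * power_sum D z = (1 + z) * (1 - of_int p)"
        "2 * power_sum D i = (1 + i) * (1 - of_int p)"
        using PD [OF 1] by (auto simp: i_def)
      have "power_sum T z = 1 + z + 2 * a - 2 * power_sum D z"
        by (simp add: T 1 a_def)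
      also have "\<dots> = 2 * a + (1 + z) * of_int p" by (simp add: p(2) algebra_simps)
      finally have Tz: "power_sum T z = 2 * a + (1 + z) * of_int p" .
      have "power_sum T i = 1 + i + 2 * a - 2 * power_sum D i"
        by (simp add: T i1 ai)
      also have "\<dots> = 2 * a + (1 + i) * of_int p" by (simp add: p(3) algebra_simps)
      finally have Ti: "power_sum T i = 2 * a + (1 + i) * of_int p" .
      have Rz: "power_sum (double M A) z = 2 * a" by (simp add: R 1 a_def)
      have "odd (- p)" "p \<noteq> 0" using p(1) by auto
      then have "2 * a \<noteq> of_int (- p)"
        unfolding a_def using 1 assms(2) by (intro even_not_odd_int_adjoin [of z M]) auto
      then have "of_int p * (2 * a + of_int p) \<noteq> 0"
        using \<open>p \<noteq> 0\<close> by (simp add: eq_neg_iff_add_eq_0)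
      then have "(1 + z) * (1 + i) * (of_int p * (2 * a + of_int p)) \<noteq> 0"
        using nz by simp
      then show ?thesis
        unfolding i_def [symmetric] Tz Ti Rz det_identity [OF zi, symmetric] by simp
    next
      case 2
      have i1: "i ^ M = - 1" using 2 by (simp add: i_def power_inverse)
      show ?thesis
        unfolding R T i_def [symmetric] 2 i1 using nz by simp
    qed
  next
    \<comment> \<open>At -1 both power sums equal twice this number; the odd size of
      \<open>A\<close> keeps the block there from being zero, which would give a kernel of dimension
      two.\<close>
    have "power_sum A (- 1) \<noteq> 0"
      using finA A(2) by (rule power_sum_minus_one_nonzero)
    then show "power_sum T (of_real (- 1)) \<noteq> 0"
      using \<open>even M\<close> by (simp add: T PD1)
    show "power_sum (double M A) (of_real (- 1)) + of_real (- 1) * power_sum T (of_real (- 1)) = 0"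
      using \<open>even M\<close> by (simp add: R T PD1)
    show "T \<subseteq> {0..<2 * M}"
      using A' assms(2) by (auto simp: T_def double_def)
  qed (use assms(1,2) symmetric_set_double [OF A(1)] in \<open>auto simp: symmetric_set_def\<close>)
  moreover have "card T = 2 + 2 * (card A - card D)"
    using disj finA D(2) finD
    by (simp add: T_def card_Un_disjoint finite_double [OF A1] card_double [OF A1] card_Diff_subset)
  moreover have "card D \<le> card A" using finA D(2) by (rule card_mono)
  then have "2 * card A + (2 + 2 * (card A - card D)) = 4 * card A + 2 - 2 * card D" by simp
  ultimately show ?thesis by (simp only: card_double [OF A'(1)])
qed

text \<open>So few elements are left out that complements are simpler: for
  \<open>z \<noteq> 1\<close> the power sums are the negated sums over the omitted elements. With
  \<open>u = z + inverse z\<close>, the negated determinant at \<open>z ^ M = 1\<close> is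
  \<open>(2 * u - 1) * (u + 2)\<close>. The first factor is nonzero by parity, the second vanishes
  only at -1. At \<open>z ^ M = -1\<close> the rotations cancel and the reflections leave
  \<open>- (1 + inverse z)\<close>.\<close>

lemma dihedral_nut_co_six:
  assumes "even M" "M \<ge> 4"
  shows "dihedral_nut (2 * M) (4 * M - 6)"
proof -
  define R where "R = {0..<2 * M} - {0, M}"
  define T where "T = {0..<2 * M} - {0, 1, 2 * M - 1, M + 1}"
  have cT: "card {0, 1, 2 * M - 1, M + 1} = 4" and cR: "card {0, M} = 2"
    using assms(2) by (auto simp: card_insert_if)
  have sub: "{0, 1, 2 * M - 1, M + 1} \<subseteq> {0..<2 * M}" "{0, M} \<subseteq> {0..<2 * M}"
    using assms(2) by auto
  have cardR: "card R = 2 * M - 2"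
    unfolding R_def using sub(2) by (subst card_Diff_subset) (simp_all add: cR del: insert_subset)
  have cardT: "card T = 2 * M - 4"
    unfolding T_def using sub(1) by (subst card_Diff_subset) (simp_all only: cT finite.intros, simp_all)
  have R: "power_sum R z = - (1 + z ^ M)" if "z ^ (2 * M) = 1" "z \<noteq> 1" for z
    unfolding R_def using sub(2) power_sum_all [OF that] assms(2)
    by (subst power_sum_Diff) auto
  have T: "power_sum T z = - (1 + z + inverse z + z ^ M * z)" if z: "z ^ (2 * M) = 1" "z \<noteq> 1" for z
  proof -
    have "inverse z = z ^ (2 * M - 1)" using z(1) assms(2) by (intro inverse_root_unity) auto
    moreover have "power_sum {0, 1, 2 * M - 1, M + 1} z = 1 + z + z ^ (2 * M - 1) + z ^ M * z"
    proof -
      have "1 \<noteq> 2 * M - 1" "1 \<noteq> M + 1" "2 * M - 1 \<noteq> M + 1" "0 \<noteq> 2 * M - 1"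
        using assms(2) by arith+
      then show ?thesis by (simp add: add.assoc)
    qed
    ultimately show ?thesis
      unfolding T_def using sub(1) power_sum_all [OF z] by (subst power_sum_Diff) simp_all
  qed
  have "dihedral_nut (2 * M) (card R + card T)"
  proof (rule dihedral_nutI [where e = "- 1" and s = 1])
    fix z :: complex assume z: "z ^ (2 * M) = 1" "z \<noteq> of_real (- 1)"
    define i where "i = inverse z"
    have z0: "z \<noteq> 0" using z assms(2) by (auto simp: power_0_left)
    have zi: "z * i = 1" using z0 by (simp add: i_def)
    show "power_sum R z * power_sum R z \<noteq> power_sum T z * power_sum T (inverse z)"
    proof (cases "z = 1")
      case True
      have "(2 * M - 2) * (2 * M - 2) \<noteq> (2 * M - 4) * (2 * M - 4)"
        using assms(2) by (simp flip: power2_eq_square)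
      then show ?thesis
        unfolding True inverse_1 power_sum_one cardR cardT by (metis of_nat_eq_iff of_nat_mult)
    next
      case False
      have i1: "i \<noteq> 1" "i ^ (2 * M) = 1" "inverse i = z"
        using False z(1) by (auto simp: i_def power_inverse)
      have Ti: "power_sum T i = - (1 + i + z + i ^ M * i)"
        using T [OF i1(2,1)] i1(3) by simp
      have Tz: "power_sum T z = - (1 + z + i + z ^ M * z)"
        using T [OF z(1) False] by (simp add: i_def)
      have z1: "1 + z \<noteq> 0" using z(2) by (simp add: add_eq_0_iff)
      have iz: "z * (1 + i) = 1 + z" using zi by (simp add: algebra_simps)
      from z(1) have "power_sum R z * power_sum R z \<noteq> power_sum T z * power_sum T i"
      proof (cases rule: root_unity_double)
        case 1
        have i1: "i ^ M = 1" using 1 by (simp add: i_def power_inverse)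
        define u where "u = z + i"
        have "power_sum T z * power_sum T i = (1 + u + z) * (1 + u + i)"
          unfolding Tz Ti 1 i1 u_def by (simp add: algebra_simps)
        also have "\<dots> = (1 + u) * (1 + u) + u * (1 + u) + z * i"
          by (simp add: u_def algebra_simps)
        finally have TT: "power_sum T z * power_sum T i - power_sum R z * power_sum R z = (2 * u - 1) * (u + 2)"
          unfolding zi R [OF z(1) False] 1 by (simp add: algebra_simps)
        have "u \<in> int_adjoin z"
          unfolding u_def i_def using 1 assms(2) by (intro int_adjoin_add int_adjoin_inverse) auto
        then have "2 * u \<noteq> of_int 1"
          using 1 assms(2) by (intro even_not_odd_int_adjoin [of z M]) auto
        moreover have "u + 2 \<noteq> 0"
          using sum_inverse_eq_two [OF z0, of "- 1"] z(2) by (auto simp: u_def i_def eq_neg_iff_add_eq_0)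
        ultimately show ?thesis using TT by auto
      next
        case 2
        have i1: "i ^ M = - 1" using 2 by (simp add: i_def power_inverse)
        have "1 + i \<noteq> 0" using z1 iz by auto
        moreover have "power_sum T z = - (1 + i)" "power_sum T i = - (1 + z)"
          unfolding Tz Ti 2 i1 by simp_all
        ultimately have "power_sum T z \<noteq> 0" "power_sum T i \<noteq> 0"
          using z1 by (simp_all only: neg_equal_0_iff_equal not_False_eq_True)
        moreover have "power_sum R z = 0" by (simp add: R [OF z(1) False] 2)
        ultimately show ?thesis by simp
      qed
      then show ?thesis by (simp add: i_def)
    qed
  next
    show "power_sum T (of_real (- 1)) \<noteq> 0"
      using T [of "- 1"] assms(1) by simp
    show "power_sum R (of_real (- 1)) + of_real 1 * power_sum T (of_real (- 1)) = 0"
      using R [of "- 1"] T [of "- 1"] assms(1) by simp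
  qed (use assms in \<open>auto simp: R_def T_def\<close>)
  moreover have "card R + card T = 4 * M - 6" using cardR cardT assms(2) by simp
  ultimately show ?thesis by simp
qed

section \<open>Dihedral groups of order 4M with M odd\<close>

text \<open>Covers the degree that \<open>dihedral_nut_double_odd\<close> misses for
  \<open>M = 3\<close> and \<open>M = 5\<close>. The sets are built from the subgroup of index two
  instead: rotations take all odd exponents, reflections all even ones with 0 exchanged for 1. Off
  \<open>z ^ 2 = 1\<close> the full cosets cancel, leaving 0 and \<open>z - 1\<close>.\<close>

lemma dihedral_nut_half:
  assumes "odd M" "M \<ge> 3"
  shows "dihedral_nut (2 * M) (2 * M)"
proof -
  define E where "E = (\<lambda>i. 2 * i) ` {0..<M}"
  define R where "R = Suc ` E"
  define T where "T = insert 1 (E - {0})"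
  have finE: "finite E" by (simp add: E_def)
  have cE: "card E = M" by (simp add: E_def card_image inj_on_def)
  have cR: "card R = M" by (simp add: R_def card_image cE)
  have E0: "0 \<in> E" "1 \<notin> E" using assms by (auto simp: E_def image_iff)
  have cT: "card T = M" using finE E0 cE assms by (simp add: T_def)
  have "power_sum E z = (\<Sum>i<M. (z\<^sup>2) ^ i)" for z
    by (simp add: E_def power_sum_def sum.reindex inj_on_def power_mult atLeast0LessThan)
  then have E: "power_sum E z = 0" if "z ^ (2 * M) = 1" "z\<^sup>2 \<noteq> 1" for z
    using that by (simp add: geometric_sum power_mult)
  have R: "power_sum R z = z * power_sum E z" for z
    by (simp add: R_def power_sum_def sum.reindex sum_distrib_left)
  have T: "power_sum T z = z - 1 + power_sum E z" for z
    using finE E0 by (simp add: T_def power_sum_Diff)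
  have E1: "power_sum E (- 1) = of_nat M"
  proof -
    have "power_sum E (- 1) = (\<Sum>e\<in>E. 1)"
      unfolding power_sum_def by (intro sum.cong refl) (auto simp: E_def)
    then show ?thesis by (simp add: cE)
  qed
  have "dihedral_nut (2 * M) (card R + card T)"
  proof (rule dihedral_nutI [where e = 1 and s = "- 1"])
    fix z :: complex assume z: "z ^ (2 * M) = 1" "z \<noteq> of_real 1"
    have z0: "z \<noteq> 0" using z assms by (auto simp: power_0_left)
    show "power_sum R z * power_sum R z \<noteq> power_sum T z * power_sum T (inverse z)"
    proof (cases "z = - 1")
      case True
      have "complex_of_real (real M * real M) \<noteq> of_real ((real M - 2) * (real M - 2))"
        unfolding of_real_eq_iff using assms(2) by (simp add: algebra_simps)
      then show ?thesis by (simp add: True R T E1 algebra_simps)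
    next
      case False
      then have z2: "z\<^sup>2 \<noteq> 1" using z(2) by (simp add: power2_eq_1_iff)
      have "inverse z ^ (2 * M) = 1" "(inverse z)\<^sup>2 \<noteq> 1"
        using z(1) z2 by (simp_all add: power_inverse)
      then show ?thesis
        using z z2 z0 by (simp add: R T E)
    qed
  next
    show "R \<subseteq> {0<..<2 * M}" by (auto simp: R_def E_def)
    show "2 * M - r \<in> R" if r: "r \<in> R" for r
    proof -
      obtain i where "i < M" "r = 2 * i + 1" using r by (auto simp: R_def E_def)
      then have "2 * M - r = Suc (2 * (M - 1 - i))" "M - 1 - i < M" by auto
      then show ?thesis unfolding R_def E_def by fastforce
    qed
    show "T \<subseteq> {0..<2 * M}" using assms(2) by (auto simp: T_def E_def)
  qed (use assms in \<open>auto simp: cR cT\<close>)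
  then show ?thesis by (simp add: cR cT mult_2)
qed

text \<open>Unpaired are the rotation \<open>M\<close> and one reflection over each of the residues
  0, -1 and 1, where 1 is lifted to \<open>M + 1\<close>. At \<open>z ^ M = -1\<close> they give
  \<open>-1\<close> and \<open>1 + inverse z - z\<close>, so the determinant is the square of
  \<open>z - inverse z\<close>. At \<open>z ^ M = 1\<close>, \<open>z \<noteq> 1\<close>, they give
  1 and \<open>1 + u\<close> with \<open>u = z + inverse z\<close>, so the determinant is
  \<open>u * u\<close> modulo 2, a unit.\<close>

lemma dihedral_nut_double_odd:
  assumes "odd M" "M \<ge> 3" "even a" "a < M" "b + 3 \<le> M" "a \<noteq> b + 1"
  shows "dihedral_nut (2 * M) (2 * (a + b + 2))"
proof -
  have "\<exists>A. symmetric_set M A \<and> {} \<subseteq> A \<and> A \<subseteq> {0<..<M} \<and> card A = card ({} :: nat set) + 2 * (a div 2)"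
    using symmetric_set_interval
    by (rule symmetric_superset) (use assms in \<open>auto simp: symmetric_set_def\<close>)
  then obtain A where A: "symmetric_set M A" "card A = a" using assms(3) by auto
  \<comment> \<open>Reflections are involutions, so \<open>B\<close> may be arbitrary; it only
    avoids 0, 1 and \<open>M - 1\<close>, the residues of \<open>S\<close>.\<close>
  have "b \<le> card {2..<M - 1}" using assms(5) by simp
  then obtain B where B: "B \<subseteq> {2..<M - 1}" "card B = b"
    by (meson obtain_subset_with_card_n)
  have A': "A \<subseteq> {0..<M}" "0 \<notin> A" using A(1) by (auto simp: symmetric_set_def)
  have B': "B \<subseteq> {0..<M}" using B(1) by (rule order_trans) auto
  have finA: "finite A" using A'(1) finite_subset by blast
  define R where "R = insert M (double M A)"
  define S where "S = {0, 2 * M - 1, M + 1}"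
  define T where "T = S \<union> double M B"
  have MR: "M \<notin> double M A" using A' by (auto simp: double_def)
  have disj: "S \<inter> double M B = {}"
  proof -
    have "2 * M - 1 = M + (M - 1)" using assms(2) by simp
    then have "(2 * M - 1) mod M = M - 1" using assms(2) by (simp only: mod_add_self1) simp
    moreover have "(M + 1) mod M = 1" using assms(2) by (simp add: mod_Suc)
    moreover have "0 \<notin> B" "1 \<notin> B" "M - 1 \<notin> B" using B(1) by auto
    ultimately show ?thesis by (auto simp: double_iff [OF B'] S_def)
  qed
  have cS: "card S = 3" using assms(2) by (auto simp: S_def card_insert_if)
  have R: "power_sum R z = z ^ M + (1 + z ^ M) * power_sum A z" for z
    using MR by (simp add: R_def finite_double [OF A'(1)] power_sum_double [OF A'(1)])
  have T: "power_sum T z = 1 + inverse z + z ^ M * z + (1 + z ^ M) * power_sum B z"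
    if "z ^ (2 * M) = 1" for z
  proof -
    have "inverse z = z ^ (2 * M - 1)" using that assms(2) by (intro inverse_root_unity) auto
    moreover have "0 \<noteq> 2 * M - 1" "2 * M - 1 \<noteq> M + 1" using assms(2) by arith+
    then have "power_sum S z = 1 + z ^ (2 * M - 1) + z ^ M * z"
      by (simp add: S_def add.assoc)
    moreover have "power_sum T z = power_sum S z + power_sum (double M B) z"
      unfolding T_def by (intro power_sum_Un finite_double [OF B'] disj) (simp add: S_def)
    ultimately show ?thesis by (simp add: power_sum_double [OF B'])
  qed
  have cR: "card R = 1 + 2 * a"
    using MR A(2) by (simp add: R_def finite_double [OF A'(1)] card_double [OF A'(1)])
  have cT: "card T = 3 + 2 * b"
  proof -
    have "card T = card S + card (double M B)"
      unfolding T_def by (intro card_Un_disjoint finite_double [OF B'] disj) (simp add: S_def)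
    then show ?thesis by (simp add: cS B(2) card_double [OF B'])
  qed
  have "dihedral_nut (2 * M) (card R + card T)"
  proof (rule dihedral_nutI [where e = "- 1" and s = 1])
    fix z :: complex assume z: "z ^ (2 * M) = 1" "z \<noteq> of_real (- 1)"
    define i where "i = inverse z"
    have z0: "z \<noteq> 0" using z assms(2) by (auto simp: power_0_left)
    have zi: "z * i = 1" "inverse i = z" using z0 by (simp_all add: i_def)
    have i2: "i ^ (2 * M) = 1" using z(1) by (simp add: i_def power_inverse)
    from z(1) have "power_sum R z * power_sum R z \<noteq> power_sum T z * power_sum T i"
    proof (cases rule: root_unity_double)
      case 1
      have i1: "i ^ M = 1" using 1 by (simp add: i_def power_inverse)
      show ?thesis
      proof (cases "z = 1")
        case True
        then have "i = 1" by (simp add: i_def)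
        \<comment> \<open>At \<open>z = 1\<close> the power sums are the cardinalities, and they
          agree exactly for \<open>a = b + 1\<close>.\<close>
        have "(1 + 2 * a) * (1 + 2 * a) \<noteq> (3 + 2 * b) * (3 + 2 * b)"
          using assms(6) by (simp flip: power2_eq_square)
        then show ?thesis
          unfolding True \<open>i = 1\<close> power_sum_one cR cT by (metis of_nat_eq_iff of_nat_mult)
      next
        case False
        define u where "u = z + i"
        \<comment> \<open>Half of the determinant plus \<open>u * u\<close>; the cross terms with
          \<open>A\<close> and \<open>B\<close> and the term \<open>- 2 * u\<close> are all
          even.\<close>
        define w where "w = 2 * (power_sum A z + power_sum A z * power_sum A z) - u
          - (1 + u) * (power_sum B z + power_sum B i) - 2 * power_sum B z * power_sum B i"
        have iin: "i \<in> int_adjoin z"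
          unfolding i_def using 1 assms(2) by (intro int_adjoin_inverse) auto
        have "power_sum R z * power_sum R z - power_sum T z * power_sum T i = 2 * w - u * u"
          unfolding R T [OF z(1)] T [OF i2] 1 i1 zi(2) i_def [symmetric] w_def u_def
          by (simp add: algebra_simps)
        moreover have "2 * w \<noteq> u * u"
        proof
          assume eq: "2 * w = u * u"
          obtain v where v: "v \<in> int_adjoin z" "v * (z + inverse z) = 1"
            using unit_root_plus_inverse [OF 1 assms(1), of z 1] False by auto
          have "2 * (v * v * w) = v * v * (2 * w)" by simp
          also have "\<dots> = (v * u) * (v * u)" unfolding eq by (simp only: mult_ac)
          also have "\<dots> = of_int 1" using v(2) by (simp add: u_def i_def)
          finally have "2 * (v * v * w) = of_int 1" .
          moreover have "v * v * w \<in> int_adjoin z"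
            unfolding w_def u_def
            by (intro int_adjoin_mult int_adjoin_diff int_adjoin_add int_adjoin_power_sum
                v(1) iin int_adjoin_self int_adjoin_numeral int_adjoin_1)
          ultimately show False
            using even_not_odd_int_adjoin [OF 1, of "v * v * w" 1] assms(2) by simp
        qed
        ultimately show ?thesis by auto
      qed
    next
      case 2
      have i1: "i ^ M = - 1" using 2 by (simp add: i_def power_inverse)
      have "power_sum T z * power_sum T i - power_sum R z * power_sum R z = - ((z - i) * (z - i))"
        unfolding R T [OF z(1)] T [OF i2] 2 i1 zi(2) i_def [symmetric]
        by (simp add: algebra_simps)
      moreover have "z \<noteq> i"
      proof
        assume "z = i"
        then have "z\<^sup>2 = 1" using zi(1) by (simp add: power2_eq_square)
        then have "z = 1" using z(2) by (simp add: power2_eq_1_iff)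
        then show False using 2 by simp
      qed
      ultimately show ?thesis by auto
    qed
    then show "power_sum R z * power_sum R z \<noteq> power_sum T z * power_sum T (inverse z)"
      by (simp add: i_def)
  next
    show "power_sum T (of_real (- 1)) \<noteq> 0"
      using T [of "- 1"] assms(1) by simp
    show "power_sum R (of_real (- 1)) + of_real 1 * power_sum T (of_real (- 1)) = 0"
      using T [of "- 1"] assms(1) by (simp add: R)
    show "T \<subseteq> {0..<2 * M}"
      using B' assms(2) by (auto simp: T_def S_def double_def)
    show "R \<subseteq> {0<..<2 * M}" "r \<in> R \<Longrightarrow> 2 * M - r \<in> R" for r
      using symmetric_set_double [OF A(1)] assms(2) by (auto simp: symmetric_set_def R_def)
  qed (use assms in auto)
  moreover have "card R + card T = 2 * (a + b + 2)" using cR cT by simp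
  ultimately show ?thesis by simp
qed

section \<open>Choice of the construction from the order and the degree\<close>

text \<open>\<open>dihedral_nut_double_sign\<close> demands a set \<open>A\<close> of odd size. Odd
  \<open>h\<close> is that size, with empty \<open>D\<close>; for even \<open>h\<close> the size is
  \<open>h + 1\<close> and a \<open>D\<close> of two residues brings the degree back to
  \<open>4 * h + 2\<close>. The latter needs \<open>h + 1\<close> of the \<open>M - 3\<close>
  residues in \<open>P\<close>, which rules out \<open>h + 2 = M\<close>; there
  \<open>dihedral_nut_co_six\<close> steps in.\<close>

lemma dihedral_nut_double_odd_degree:
  assumes "even M" "h \<ge> 1" "h + 2 \<le> M"
  shows "dihedral_nut (2 * M) (4 * h + 2)"
proof -
  have M4: "M \<ge> 4" using assms by presburger
  define P where "P = {0<..<M} - {1, M - 1}"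
  have symP: "symmetric_set M P" using M4 by (auto simp: P_def symmetric_set_def)
  have "{1, M - 1} \<subseteq> {0<..<M}" "1 \<noteq> M - 1" using M4 by auto
  then have cP: "card P = M - 3"
    by (simp add: P_def card_Diff_subset)
  have "odd h \<or> even h \<and> h + 2 = M \<or> even h \<and> h + 4 \<le> M"
    using assms by presburger
  then consider "odd h" | "even h" "h + 2 = M" | "even h" "h + 4 \<le> M" by blast
  then show ?thesis
  proof cases
    case 1
    define K where "K = {M div 2}"
    have K: "symmetric_set M K" "K \<subseteq> P" "card K = 1"
      using M4 \<open>even M\<close> by (auto simp: K_def P_def symmetric_set_def)
    have "card K + 2 * ((h - 1) div 2) = h" using 1 K(3) by simp
    moreover have "h \<le> card P" using 1 assms cP by presburger
    ultimately obtain A where A: "symmetric_set M A" "A \<subseteq> P" "card A = h"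
      using symmetric_superset [OF symP K(1,2), of "(h - 1) div 2"] by auto
    have "dihedral_nut (2 * M) (4 * card A + 2 - 2 * card ({} :: nat set))"
      using assms(1) M4 A(1) by (rule dihedral_nut_double_sign) (use A 1 in \<open>auto simp: P_def\<close>)
    then show ?thesis by (simp add: A(3))
  next
    case 2
    then have "4 * M - 6 = 4 * h + 2" by auto
    then show ?thesis using dihedral_nut_co_six [OF assms(1) M4] by simp
  next
    case 3
    \<comment> \<open>\<open>D\<close> consists of the first two residues; the third restores
      symmetry. From \<open>M \<ge> 6\<close> none of them is 1 or \<open>M - 1\<close>.\<close>
    define K where "K = {M div 2, M div 2 + 1, M div 2 - 1}"
    have M6: "M \<ge> 6" using 3 assms by presburger
    have K: "symmetric_set M K" "K \<subseteq> P" "card K = 3"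
      using M6 \<open>even M\<close> by (auto simp: K_def P_def symmetric_set_def)
    have "card K + 2 * ((h - 2) div 2) = h + 1" using 3 assms(2) K(3) by presburger
    moreover have "h + 1 \<le> card P" using 3 cP by simp
    ultimately obtain A where A: "symmetric_set M A" "K \<subseteq> A" "A \<subseteq> P" "card A = h + 1"
      using symmetric_superset [OF symP K(1,2), of "(h - 2) div 2"] by auto
    have "dihedral_nut (2 * M) (4 * card A + 2 - 2 * card {M div 2, M div 2 + 1})"
      using assms(1) M4 A(1)
      by (rule dihedral_nut_double_sign) (use A 3 in \<open>auto simp: P_def K_def\<close>)
    then show ?thesis by (simp add: A(4))
  qed
qed

text \<open>Below \<open>M\<close> all of \<open>k - 2\<close> goes into \<open>b\<close>. Above
  \<open>M\<close>, \<open>b\<close> takes its maximum \<open>M - 3\<close> or one less, whichever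
  leaves \<open>a\<close> even. Only \<open>k = 2 * M - 5\<close> would then hit the forbidden
  \<open>a = b + 1\<close>, so there \<open>a\<close> rises to \<open>M - 1\<close> and
  \<open>b\<close> drops to \<open>M - 6\<close>.\<close>

lemma dihedral_nut_odd_half:
  assumes "odd M" "M \<ge> 3" "k \<ge> 2" "k + 2 \<le> 2 * M"
  shows "dihedral_nut (2 * M) (2 * k)"
proof (cases "k = M")
  case True
  then show ?thesis using dihedral_nut_half [OF assms(1,2)] by simp
next
  case False
  have "\<exists>a b. even a \<and> a < M \<and> b + 3 \<le> M \<and> a \<noteq> b + 1 \<and> a + b + 2 = k"
  proof -
    have "k + 1 \<le> M \<or> even k \<and> M < k \<or> odd k \<and> M + 2 \<le> k \<and> k + 5 \<noteq> 2 * M \<or> k + 5 = 2 * M \<and> M + 2 \<le> k"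
      using False assms by presburger
    then consider "k + 1 \<le> M" | "even k" "M < k" | "odd k" "M + 2 \<le> k" "k + 5 \<noteq> 2 * M"
      | "k + 5 = 2 * M" "M + 2 \<le> k"
      by blast
    then show ?thesis
    proof cases
      case 1
      then show ?thesis using assms by (intro exI [of _ 0] exI [of _ "k - 2"]) auto
    next
      case 2
      have "even (k + 1 - M)" "k + 1 - M < M" "M - 3 + 3 \<le> M" "k + 1 - M \<noteq> M - 3 + 1"
        "k + 1 - M + (M - 3) + 2 = k"
        using 2 assms by presburger+
      then show ?thesis by blast
    next
      case 3
      have "even (k + 2 - M)" "k + 2 - M < M" "M - 4 + 3 \<le> M" "k + 2 - M \<noteq> M - 4 + 1"
        "k + 2 - M + (M - 4) + 2 = k"
        using 3 assms by presburger+
      then show ?thesis by blast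
    next
      case 4
      have "even (M - 1)" "M - 1 < M" "M - 6 + 3 \<le> M" "M - 1 \<noteq> M - 6 + 1" "M - 1 + (M - 6) + 2 = k"
        using 4 assms by presburger+
      then show ?thesis by blast
    qed
  qed
  then obtain a b where "even a" "a < M" "b + 3 \<le> M" "a \<noteq> b + 1" "a + b + 2 = k" by blast
  then show ?thesis using dihedral_nut_double_odd [OF assms(1,2), of a b] by simp
qed

lemma cyclic_or_dihedral_nut:
  assumes "k \<ge> 2" "k + 2 \<le> m" "even m \<or> even k"
  shows "cyclic_nut (2 * m) (2 * k) \<or> dihedral_nut m (2 * k)"
proof (cases "even m")
  case False
  then show ?thesis using cyclic_nut_odd [of m k] assms by blast
next
  case True
  then obtain M where m: "m = 2 * M" by blast
  have "dihedral_nut (2 * M) (2 * k)"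
  proof (cases "even M")
    case False
    moreover have "M \<ge> 3" using False assms m by presburger
    ultimately show ?thesis using dihedral_nut_odd_half assms m by blast
  next
    case True
    show ?thesis
    proof (cases "even k")
      case False
      then obtain h where "k = 2 * h + 1" by (rule oddE)
      moreover have "h \<ge> 1" "h + 2 \<le> M" using calculation assms m by presburger+
      ultimately show ?thesis using dihedral_nut_double_odd_degree [OF True, of h] by simp
    next
      case k: True
      then obtain g where g: "k = 2 * g" by (rule evenE)
      show ?thesis
      proof (cases "g \<ge> 2")
        case True
        moreover have "g < M" using assms g m by simp
        ultimately show ?thesis using dihedral_nut_double_even [OF \<open>even M\<close>, of g] g by simp
      next
        \<comment> \<open>For \<open>g = 1\<close> the set \<open>A\<close> of
          \<open>dihedral_nut_double_even\<close> cannot contain both 1 and \<open>M - 1\<close>,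
          hence the separate graph of degree four.\<close>
        case False
        then have "k = 2" using g assms by simp
        moreover obtain q where q: "M = 2 * q" using \<open>even M\<close> by (rule evenE)
        moreover have "q \<ge> 1" using q assms m by simp
        ultimately show ?thesis using dihedral_nut_four [of q] by simp
      qed
    qed
  qed
  then show ?thesis by (simp add: m)
qed

theorem mainTheorem17:
  fixes n d :: nat
  assumes "n \<ge> 1"
    and "even n" and "even d" and "4 dvd n \<or> 4 dvd d"
    and "d \<ge> 4" and "n \<ge> d + 4"
  shows "(\<exists>C. connection_set (cyclic_group n) C \<and>
             card (carrier (cyclic_group n)) = n \<and>
             regular_graph (carrier (cyclic_group n)) (cayley_adj (cyclic_group n) C) d \<and>
             nut_graph (carrier (cyclic_group n)) (cayley_adj (cyclic_group n) C))
       \<or> (\<exists>m C. m \<ge> 3 \<and> 2 * m = n \<and> connection_set (dihedral_group m) C \<and>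
             card (carrier (dihedral_group m)) = n \<and>
             regular_graph (carrier (dihedral_group m)) (cayley_adj (dihedral_group m) C) d \<and>
             nut_graph (carrier (dihedral_group m)) (cayley_adj (dihedral_group m) C))"
proof -
  obtain m where m: "n = 2 * m" using \<open>even n\<close> by (rule evenE)
  obtain k where k: "d = 2 * k" using \<open>even d\<close> by (rule evenE)
  have "even m \<or> even k" using \<open>4 dvd n \<or> 4 dvd d\<close> unfolding m k by presburger
  then have "cyclic_nut n d \<or> dihedral_nut m d"
    using cyclic_or_dihedral_nut [of k m] assms(5,6) m k by simp
  then show ?thesis
  proof
    assume "cyclic_nut n d"
    then show ?thesis unfolding cyclic_nut_def by (rule disjI1)
  next
    assume "dihedral_nut m d"
    moreover have "m \<ge> 3" using assms(5,6) m by simp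
    ultimately show ?thesis unfolding dihedral_nut_def m by blast
  qed
qed

end
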